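(* Any homomorphic image of the free special Tortkara algebra $ST(\{x,y\})$ on two generators is special. For three generators this statement is not true: there exists a homomorphic image of the free special Tortkara algebra $ST(\{x,y,z\})$ on three generators that is not special.
   Context: All algebras are over a field $\mathbf{K}$ of characteristic $0$. A (right-)Zinbiel algebra is an algebra with product $\circ$ satisfying $a\circ(b\circ c)=(a\circ b+b\circ a)\circ c$. A Tortkara algebra is an anticommutative algebra satisfying $(ab)(cb)=J(a,b,c)b$, where $J(a,b,c)=(ab)c+(bc)a+(ca)b$. For any Zinbiel algebra $A$, the algebra $A^{(-)}$ with the same vector space and product $[a,b]=a\circ b-b\circ a$ is a Tortkara algebra. A Tortkara algebra $B$ is called special if there exists a Zinbiel algebra $A$ such that $B$ is (isomorphic to) a subalgebra of $A^{(-)}$. The free special Tortkara algebra $ST(X)$ on a set $X$ is the subalgebra of $Zin(X)^{(-)}$ generated by $X$, where $Zin(X)$ is the free Zinbiel algebra on $X$. *)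

theory Defs
  imports Complex_Main "HOL-Library.Poly_Mapping" "HOL-Library.Multiset"
begin

section \<open>Nonassociative algebras over a field\<close>

text \<open>
  The carrier of an algebra is a linear subspace of an ambient vector space, whose addition is
  the one of the type class and whose scalar multiplication is a field of the record.
\<close>

record ('k, 'v) alg =
  carr :: "'v set"
  scl :: "'k \<Rightarrow> 'v \<Rightarrow> 'v"
  mul :: "'v \<Rightarrow> 'v \<Rightarrow> 'v"

definition is_algebra :: "('k::field, 'v::ab_group_add) alg \<Rightarrow> bool" where
  "is_algebra A \<longleftrightarrow>
     vector_space (scl A) \<and>
     module.subspace (scl A) (carr A) \<and>
     (\<forall>a\<in>carr A. \<forall>b\<in>carr A. mul A a b \<in> carr A) \<and>
     (\<forall>a\<in>carr A. \<forall>b\<in>carr A. \<forall>c\<in>carr A. mul A (a + b) c = mul A a c + mul A b c) \<and>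
     (\<forall>a\<in>carr A. \<forall>b\<in>carr A. \<forall>c\<in>carr A. mul A a (b + c) = mul A a b + mul A a c) \<and>
     (\<forall>r. \<forall>a\<in>carr A. \<forall>b\<in>carr A. mul A (scl A r a) b = scl A r (mul A a b)) \<and>
     (\<forall>r. \<forall>a\<in>carr A. \<forall>b\<in>carr A. mul A a (scl A r b) = scl A r (mul A a b))"

definition subalgebra :: "'v set \<Rightarrow> ('k::field, 'v::ab_group_add) alg \<Rightarrow> bool" where
  "subalgebra U A \<longleftrightarrow>
     U \<subseteq> carr A \<and> module.subspace (scl A) U \<and> (\<forall>a\<in>U. \<forall>b\<in>U. mul A a b \<in> U)"

definition generated_subalgebra ::
  "('k::field, 'v::ab_group_add) alg \<Rightarrow> 'v set \<Rightarrow> ('k, 'v) alg" where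
  "generated_subalgebra A S = A\<lparr>carr := \<Inter>{U. subalgebra U A \<and> S \<subseteq> U}\<rparr>"

definition alg_hom ::
  "('v \<Rightarrow> 'w) \<Rightarrow> ('k::field, 'v::ab_group_add) alg \<Rightarrow> ('k, 'w::ab_group_add) alg \<Rightarrow> bool" where
  "alg_hom f A B \<longleftrightarrow>
     (\<forall>a\<in>carr A. f a \<in> carr B) \<and>
     (\<forall>a\<in>carr A. \<forall>b\<in>carr A. f (a + b) = f a + f b) \<and>
     (\<forall>r. \<forall>a\<in>carr A. f (scl A r a) = scl B r (f a)) \<and>
     (\<forall>a\<in>carr A. \<forall>b\<in>carr A. f (mul A a b) = mul B (f a) (f b))"

definition isomorphic ::
  "('k::field, 'v::ab_group_add) alg \<Rightarrow> ('k, 'w::ab_group_add) alg \<Rightarrow> bool" where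
  "isomorphic A B \<longleftrightarrow> (\<exists>f. alg_hom f A B \<and> bij_betw f (carr A) (carr B))"

definition homomorphic_image ::
  "('k::field, 'v::ab_group_add) alg \<Rightarrow> ('k, 'w::ab_group_add) alg \<Rightarrow> bool" where
  "homomorphic_image A B \<longleftrightarrow> is_algebra B \<and> (\<exists>f. alg_hom f A B \<and> f ` carr A = carr B)"


section \<open>Zinbiel and Tortkara algebras\<close>

definition zinbiel :: "('k::field, 'v::ab_group_add) alg \<Rightarrow> bool" where
  "zinbiel A \<longleftrightarrow> is_algebra A \<and>
     (\<forall>a\<in>carr A. \<forall>b\<in>carr A. \<forall>c\<in>carr A.
        mul A a (mul A b c) = mul A (mul A a b + mul A b a) c)"

definition jacobian :: "('k::field, 'v::ab_group_add) alg \<Rightarrow> 'v \<Rightarrow> 'v \<Rightarrow> 'v \<Rightarrow> 'v" where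
  "jacobian A a b c = mul A (mul A a b) c + mul A (mul A b c) a + mul A (mul A c a) b"

definition tortkara :: "('k::field, 'v::ab_group_add) alg \<Rightarrow> bool" where
  "tortkara A \<longleftrightarrow> is_algebra A \<and>
     (\<forall>a\<in>carr A. \<forall>b\<in>carr A. mul A a b = - mul A b a) \<and>
     (\<forall>a\<in>carr A. \<forall>b\<in>carr A. \<forall>c\<in>carr A.
        mul A (mul A a b) (mul A c b) = mul A (jacobian A a b c) b)"

definition minus_algebra :: "('k::field, 'v::ab_group_add) alg \<Rightarrow> ('k, 'v) alg" where
  "minus_algebra A = A\<lparr>mul := \<lambda>a b. mul A a b - mul A b a\<rparr>"

text \<open>
  HOL cannot quantify over the type underlying the Zinbiel algebra \<open>A\<close>. The type
  \<^typ>\<open>'v list \<Rightarrow>\<^sub>0 'k\<close> used below is large enough: lemma \<open>special_if_embeds\<close> at the end of this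
  theory shows that a Tortkara algebra that embeds into \<open>A\<^sup>(\<^sup>-\<^sup>)\<close> for a Zinbiel algebra \<open>A\<close> over any
  type whatsoever is special in this sense.
\<close>

definition special :: "('k::field, 'v::ab_group_add) alg \<Rightarrow> bool" where
  "special B \<longleftrightarrow> tortkara B \<and>
     (\<exists>(A :: ('k, 'v list \<Rightarrow>\<^sub>0 'k) alg) U.
        zinbiel A \<and> subalgebra U (minus_algebra A) \<and>
        isomorphic B ((minus_algebra A)\<lparr>carr := U\<rparr>))"


section \<open>The free Zinbiel algebra and the free special Tortkara algebra\<close>

text \<open>The multiset of all shuffles of two words. (The library's \<^const>\<open>shuffles\<close> is only a set.)\<close>

fun shuffle :: "'x list \<Rightarrow> 'x list \<Rightarrow> 'x list multiset" where
  "shuffle [] v = {#v#}"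
| "shuffle u [] = {#u#}"
| "shuffle (a # u) (b # v) =
     image_mset (Cons a) (shuffle u (b # v)) + image_mset (Cons b) (shuffle (a # u) v)"

definition pm_scale :: "'k::field \<Rightarrow> ('a \<Rightarrow>\<^sub>0 'k) \<Rightarrow> 'a \<Rightarrow>\<^sub>0 'k" where
  "pm_scale r p = Poly_Mapping.map (\<lambda>c. r * c) p"

text \<open>
  The bilinear extension of \<open>u \<circ> (v x) = (u \<squnion> v) x\<close>, where \<open>x\<close> is a letter and \<open>\<squnion>\<close> the shuffle
  product. Its value on the empty word plays no role.
\<close>

definition zin_mul :: "('x list \<Rightarrow>\<^sub>0 'k::field) \<Rightarrow> ('x list \<Rightarrow>\<^sub>0 'k) \<Rightarrow> 'x list \<Rightarrow>\<^sub>0 'k" where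
  "zin_mul p q =
     (\<Sum>u\<in>Poly_Mapping.keys p. \<Sum>v\<in>Poly_Mapping.keys q. \<Sum>w\<in>#shuffle u (butlast v).
        Poly_Mapping.single (w @ [last v]) (Poly_Mapping.lookup p u * Poly_Mapping.lookup q v))"

text \<open>
  Loday's model of the free Zinbiel algebra: linear combinations of nonempty words.
  Lemmas \<open>zinbiel_Zin\<close>, \<open>Zin_extend\<close> and \<open>Zin_unique\<close> establish its universal property.
\<close>

definition Zin :: "'x set \<Rightarrow> ('k::field, 'x list \<Rightarrow>\<^sub>0 'k) alg" where
  "Zin X = \<lparr>carr = {p. \<forall>w\<in>Poly_Mapping.keys p. w \<noteq> [] \<and> set w \<subseteq> X},
            scl = pm_scale, mul = zin_mul\<rparr>"

definition letter :: "'x \<Rightarrow> 'x list \<Rightarrow>\<^sub>0 'k::field" where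
  "letter x = Poly_Mapping.single [x] 1"

definition ST :: "'x set \<Rightarrow> ('k::field, 'x list \<Rightarrow>\<^sub>0 'k) alg" where
  "ST X = generated_subalgebra (minus_algebra (Zin X)) (letter ` X)"


section \<open>Properties of the free Zinbiel algebra\<close>

lemma shuffle_Nil2 [simp]: "shuffle u [] = {#u#}"
  by (cases u) auto

lemma shuffle_commute: "shuffle u v = shuffle v u"
  by (induction u v rule: shuffle.induct) (auto simp: add.commute)

lemma set_shuffle: "w \<in># shuffle u v \<Longrightarrow> set w = set u \<union> set v"
  by (induction u v arbitrary: w rule: shuffle.induct) auto

lemma shuffle_snoc:
  "shuffle (u @ [a]) (v @ [b]) =
     image_mset (\<lambda>w. w @ [a]) (shuffle u (v @ [b])) + image_mset (\<lambda>w. w @ [b]) (shuffle (u @ [a]) v)"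
proof (induction u v rule: shuffle.induct)
  case (1 v)
  show ?case by (induction v) (auto simp: image_mset.compositionality o_def)
next
  case (2 c u)
  have "shuffle (w @ [a]) [b] = add_mset (w @ [a, b]) (image_mset (\<lambda>w. w @ [a]) (shuffle w [b]))" for w
    by (induction w) (auto simp: image_mset.compositionality o_def)
  from this[of "c # u"] show ?case by (simp)
next
  case (3 c u d v)
  then show ?case by (simp add: image_mset.compositionality o_def ac_simps)
qed

lemma image_Union_mset: "image_mset f (\<Sum>\<^sub># M) = \<Sum>\<^sub># (image_mset (image_mset f) M)"
  by (induction M) auto

lemma sum_shuffle_Nil [simp]: "(\<Sum>s\<in>#M. shuffle [] s) = M" "(\<Sum>s\<in>#M. shuffle s []) = M"
  by (induction M) auto

lemma shuffle_assoc:
  "(\<Sum>s\<in>#shuffle v w. shuffle u s) = (\<Sum>s\<in>#shuffle u v. shuffle s w)"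
proof (induction "length u + length v + length w" arbitrary: u v w rule: less_induct)
  case less
  show ?case
  proof (cases "u = [] \<or> v = [] \<or> w = []")
    case True
    then show ?thesis by auto
  next
    case False
    then obtain a u' b v' c w' where eq: "u = a # u'" "v = b # v'" "w = c # w'"
      by (meson list.exhaust)
    have vw: "shuffle v w = image_mset (Cons b) (shuffle v' w) + image_mset (Cons c) (shuffle v w')"
      and uv: "shuffle u v = image_mset (Cons a) (shuffle u' v) + image_mset (Cons b) (shuffle u v')"
      by (simp_all add: eq)
    have l: "(\<Sum>s\<in>#M. shuffle u (d # s)) =
      image_mset (Cons a) (\<Sum>s\<in>#M. shuffle u' (d # s)) + image_mset (Cons d) (\<Sum>s\<in>#M. shuffle u s)" for M d
      unfolding eq by (induction M) (auto simp: ac_simps)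
    have r: "(\<Sum>s\<in>#M. shuffle (d # s) w) =
      image_mset (Cons d) (\<Sum>s\<in>#M. shuffle s w) + image_mset (Cons c) (\<Sum>s\<in>#M. shuffle (d # s) w')" for M d
      unfolding eq by (induction M) (auto simp: ac_simps)
    have "(\<Sum>s\<in>#shuffle v w. shuffle u s) =
       image_mset (Cons a) (\<Sum>s\<in>#shuffle v w. shuffle u' s)
       + image_mset (Cons b) (\<Sum>s\<in>#shuffle v' w. shuffle u s)
       + image_mset (Cons c) (\<Sum>s\<in>#shuffle v w'. shuffle u s)"
      by (simp add: vw l image_mset.compositionality o_def ac_simps)
    also have "\<dots> = image_mset (Cons a) (\<Sum>s\<in>#shuffle u' v. shuffle s w)
       + image_mset (Cons b) (\<Sum>s\<in>#shuffle u v'. shuffle s w)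
       + image_mset (Cons c) (\<Sum>s\<in>#shuffle u v. shuffle s w')"
      using less[of u' v w] less[of u v' w] less[of u v w'] by (simp add: eq)
    also have "\<dots> = (\<Sum>s\<in>#shuffle u v. shuffle s w)"
      by (simp add: uv r image_mset.compositionality o_def ac_simps)
    finally show ?thesis .
  qed
qed

lemma lookup_pm_scale [simp]: "Poly_Mapping.lookup (pm_scale r p) w = r * Poly_Mapping.lookup p w"
  unfolding pm_scale_def by (simp add: Poly_Mapping.map.rep_eq when_def)

lemma pm_scale_single [simp]: "pm_scale r (Poly_Mapping.single w c) = Poly_Mapping.single w (r * c)"
  by (rule poly_mapping_eqI) (simp add: lookup_single when_def)

lemma vector_space_pm_scale: "vector_space pm_scale"
  by unfold_locales (auto intro!: poly_mapping_eqI simp: lookup_add algebra_simps)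

interpretation pm: vector_space "pm_scale :: 'k::field \<Rightarrow> ('a \<Rightarrow>\<^sub>0 'k) \<Rightarrow> 'a \<Rightarrow>\<^sub>0 'k"
  by (rule vector_space_pm_scale)

definition lin_ext :: "('k::field \<Rightarrow> 'v \<Rightarrow> 'v::ab_group_add) \<Rightarrow> ('a \<Rightarrow> 'v) \<Rightarrow> ('a \<Rightarrow>\<^sub>0 'k) \<Rightarrow> 'v" where
  "lin_ext s e p = (\<Sum>w\<in>Poly_Mapping.keys p. s (Poly_Mapping.lookup p w) (e w))"

context vector_space begin

lemma lin_ext_superset:
  assumes "finite S" "Poly_Mapping.keys p \<subseteq> S"
  shows "lin_ext scale e p = (\<Sum>w\<in>S. scale (Poly_Mapping.lookup p w) (e w))"
  unfolding lin_ext_def using assms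
  by (intro sum.mono_neutral_left) (auto simp: in_keys_iff)

lemma lin_ext_add: "lin_ext scale e (p + q) = lin_ext scale e p + lin_ext scale e q"
proof -
  let ?S = "Poly_Mapping.keys p \<union> Poly_Mapping.keys q"
  have "Poly_Mapping.keys (p + q) \<subseteq> ?S" by (rule Poly_Mapping.keys_add)
  then show ?thesis
    using lin_ext_superset[of ?S "p + q" e] lin_ext_superset[of ?S p e] lin_ext_superset[of ?S q e]
    by (simp add: lookup_add scale_left_distrib sum.distrib)
qed

lemma lin_ext_scale: "lin_ext scale e (pm_scale r p) = scale r (lin_ext scale e p)"
proof -
  have "Poly_Mapping.keys (pm_scale r p) \<subseteq> Poly_Mapping.keys p" by (auto simp: in_keys_iff)
  then show ?thesis
    using lin_ext_superset[of "Poly_Mapping.keys p" "pm_scale r p" e]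
    by (simp add: lin_ext_def scale_sum_right)
qed

lemma lin_ext_single: "lin_ext scale e (Poly_Mapping.single w c) = scale c (e w)"
  by (simp add: lin_ext_def)

lemma linear_lin_ext: "Vector_Spaces.linear pm_scale scale (lin_ext scale e)"
  by (intro Vector_Spaces.linear.intro module_hom.intro vector_space_pm_scale vector_space_axioms
        module_hom_axioms.intro lin_ext_add lin_ext_scale)
    (auto simp: module_iff_vector_space vector_space_pm_scale vector_space_axioms)

end

lemma pm_induct [consumes 1, case_names zero add single]:
  assumes "\<forall>w\<in>Poly_Mapping.keys p. w \<in> S"
    and "P 0"
    and "\<And>p q. \<lbrakk>\<forall>w\<in>Poly_Mapping.keys p. w \<in> S; \<forall>w\<in>Poly_Mapping.keys q. w \<in> S; P p; P q\<rbrakk> \<Longrightarrow> P (p + q)"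
    and "\<And>w c. w \<in> S \<Longrightarrow> P (Poly_Mapping.single w c)"
  shows "P p"
  using assms(1)
proof (induction p rule: update_induct)
  case const
  then show ?case using assms(2) by simp
next
  case (update p w c)
  have eq: "Poly_Mapping.update w c p = p + Poly_Mapping.single w c"
    using update(1) by (intro poly_mapping_eqI) (auto simp: lookup_update lookup_add lookup_single when_def in_keys_iff)
  have k: "Poly_Mapping.keys (Poly_Mapping.update w c p) = insert w (Poly_Mapping.keys p)"
    using update(2) by (auto simp: in_keys_iff lookup_update split: if_splits)
  show ?case unfolding eq
    by (rule assms(3)) (use update k assms(4) in auto)
qed


definition word_sum :: "'x list multiset \<Rightarrow> 'x list \<Rightarrow>\<^sub>0 'k::field" where
  "word_sum M = (\<Sum>w\<in>#M. Poly_Mapping.single w 1)"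

lemma word_sum_simps [simp]:
  "word_sum {#} = 0"
  "word_sum (add_mset w M) = Poly_Mapping.single w 1 + word_sum M"
  "word_sum (M + N) = word_sum M + word_sum N"
  by (auto simp: word_sum_def)

definition zin_word :: "'x list \<Rightarrow> 'x list \<Rightarrow> 'x list \<Rightarrow>\<^sub>0 'k::field" where
  "zin_word u v = word_sum (image_mset (\<lambda>w. w @ [last v]) (shuffle u (butlast v)))"

lemma zin_mul_eq: "zin_mul p q = lin_ext pm_scale (\<lambda>u. lin_ext pm_scale (zin_word u) q) p"
proof -
  have "(\<Sum>w\<in>#M. Poly_Mapping.single (w @ [x]) c) =
      pm_scale c (word_sum (image_mset (\<lambda>w. w @ [x]) M))" for M :: "'a list multiset" and x and c :: 'b
    by (induction M) (auto simp: pm.scale_right_distrib)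
  then show ?thesis
    by (simp add: zin_mul_def lin_ext_def zin_word_def pm.scale_sum_right)
qed

lemma zin_mul_add_left: "zin_mul (p + p') q = zin_mul p q + zin_mul p' q"
  by (simp add: zin_mul_eq pm.lin_ext_add)

lemma zin_mul_add_right: "zin_mul p (q + q') = zin_mul p q + zin_mul p q'"
  by (simp add: zin_mul_eq pm.lin_ext_add) (simp add: lin_ext_def pm.scale_right_distrib sum.distrib)

lemma zin_mul_scale_left: "zin_mul (pm_scale r p) q = pm_scale r (zin_mul p q)"
  by (simp add: zin_mul_eq pm.lin_ext_scale)

lemma zin_mul_scale_right: "zin_mul p (pm_scale r q) = pm_scale r (zin_mul p q)"
  by (simp add: zin_mul_eq pm.lin_ext_scale) (simp add: lin_ext_def pm.scale_sum_right ac_simps)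

lemma zin_mul_zero [simp]: "zin_mul 0 q = 0" "zin_mul p 0 = 0"
  by (simp_all add: zin_mul_def)

lemma zin_mul_single:
  "zin_mul (Poly_Mapping.single u a) (Poly_Mapping.single v b) = pm_scale (a * b) (zin_word u v)"
  by (simp add: zin_mul_eq pm.lin_ext_single)

lemma zin_mul_single_sum:
  "zin_mul (Poly_Mapping.single u 1) (word_sum (image_mset (\<lambda>w. w @ [x]) M)) =
     word_sum (image_mset (\<lambda>w. w @ [x]) (\<Sum>s\<in>#M. shuffle u s))"
  by (induction M) (auto simp: zin_mul_add_right zin_mul_single zin_word_def)

lemma zin_mul_sum_single:
  "zin_mul (word_sum M) (Poly_Mapping.single (w @ [x]) 1) =
     word_sum (image_mset (\<lambda>w. w @ [x]) (\<Sum>s\<in>#M. shuffle s w))"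
  by (induction M) (auto simp: zin_mul_add_left zin_mul_single zin_word_def)

lemma shuffle_eq_half_shuffles:
  assumes "u \<noteq> []" "v \<noteq> []"
  shows "shuffle u v = image_mset (\<lambda>w. w @ [last v]) (shuffle u (butlast v)) +
                       image_mset (\<lambda>w. w @ [last u]) (shuffle v (butlast u))"
proof -
  obtain u' a v' b where "u = u' @ [a]" "v = v' @ [b]" using assms by (metis rev_exhaust)
  then show ?thesis by (simp add: shuffle_snoc shuffle_commute[of u' "v' @ [b]"])
qed

lemma zin_word_zinbiel:
  assumes "u \<noteq> []" "v \<noteq> []" "w \<noteq> []"
  shows "zin_mul (Poly_Mapping.single u 1) (zin_word v w) =
         zin_mul (zin_word u v + zin_word v u) (Poly_Mapping.single w 1)"
proof -
  obtain w' x where w: "w = w' @ [x]" using assms by (metis rev_exhaust)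
  have *: "zin_word u v + zin_word v u = word_sum (shuffle u v)"
    using shuffle_eq_half_shuffles[OF assms(1,2)] by (simp add: zin_word_def)
  show ?thesis
    unfolding * w zin_mul_sum_single by (simp add: zin_word_def zin_mul_single_sum shuffle_assoc)
qed

lemma zin_mul_zinbiel:
  assumes "\<forall>w\<in>Poly_Mapping.keys p. w \<in> - {[]}" "\<forall>w\<in>Poly_Mapping.keys q. w \<in> - {[]}"
    "\<forall>w\<in>Poly_Mapping.keys r. w \<in> - {[]}"
  shows "zin_mul p (zin_mul q r) = zin_mul (zin_mul p q + zin_mul q p) r"
  using assms(1)
proof (induction p rule: pm_induct)
  case (single u a)
  show ?case using assms(2)
  proof (induction q rule: pm_induct)
    case (single v b)
    show ?case using assms(3)
    proof (induction r rule: pm_induct)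
      case (single w c)
      have uvw: "u \<noteq> []" "v \<noteq> []" "w \<noteq> []"
        using single \<open>u \<in> - {[]}\<close> \<open>v \<in> - {[]}\<close> by auto
      define U V W where UVW: "U = Poly_Mapping.single u (1::'b)" "V = Poly_Mapping.single v (1::'b)"
        "W = Poly_Mapping.single w (1::'b)"
      have eqs: "Poly_Mapping.single u a = pm_scale a U" "Poly_Mapping.single v b = pm_scale b V"
        "Poly_Mapping.single w c = pm_scale c W"
        by (simp_all add: UVW)
      have "zin_mul U (zin_mul V W) = zin_mul (zin_mul U V + zin_mul V U) W"
        using zin_word_zinbiel[OF uvw] by (simp add: UVW zin_mul_single)
      then show ?case
        unfolding eqs
        by (simp add: zin_mul_scale_left zin_mul_scale_right zin_mul_add_left ac_simps
            pm.scale_right_distrib)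
    qed (auto simp: zin_mul_add_right zin_mul_add_left)
  qed (auto simp: zin_mul_add_right zin_mul_add_left)
qed (auto simp: zin_mul_add_right zin_mul_add_left)

lemma carr_Zin: "p \<in> carr (Zin X) \<longleftrightarrow> (\<forall>w\<in>Poly_Mapping.keys p. w \<in> {w. w \<noteq> [] \<and> set w \<subseteq> X})"
  by (simp add: Zin_def)

lemma Zin_simps [simp]: "scl (Zin X) = pm_scale" "mul (Zin X) = zin_mul"
  by (simp_all add: Zin_def)

lemma letter_in_Zin: "x \<in> X \<Longrightarrow> letter x \<in> carr (Zin X)"
  by (simp add: carr_Zin letter_def)

lemma subspace_Zin: "pm.subspace (carr (Zin X :: ('k::field, 'x list \<Rightarrow>\<^sub>0 'k) alg))"
proof (rule pm.subspaceI)
  fix p q :: "'x list \<Rightarrow>\<^sub>0 'k" assume "p \<in> carr (Zin X)" "q \<in> carr (Zin X)"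
  then show "p + q \<in> carr (Zin X)"
    using Poly_Mapping.keys_add[of p q] unfolding carr_Zin by blast
qed (auto simp: carr_Zin in_keys_iff)

lemma word_sum_in_Zin:
  "(\<And>w. w \<in># M \<Longrightarrow> w \<noteq> [] \<and> set w \<subseteq> X) \<Longrightarrow> word_sum M \<in> carr (Zin X)"
proof (induction M)
  case empty
  then show ?case using subspace_Zin pm.subspace_0 by auto
next
  case (add w M)
  have "Poly_Mapping.single w 1 \<in> carr (Zin X)" using add.prems[of w] by (simp add: carr_Zin)
  then show ?case using add by (auto intro!: pm.subspace_add[OF subspace_Zin])
qed

lemma zin_word_in_Zin:
  assumes "set u \<subseteq> X" "v \<noteq> []" "set v \<subseteq> X"
  shows "zin_word u v \<in> carr (Zin X)"
proof -
  obtain v' x where "v = v' @ [x]" using assms(2) by (metis rev_exhaust)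
  then show ?thesis
    unfolding zin_word_def using assms by (intro word_sum_in_Zin) (auto dest!: set_shuffle)
qed

lemma zin_mul_in_Zin:
  assumes "p \<in> carr (Zin X)" "q \<in> carr (Zin X)"
  shows "zin_mul p q \<in> carr (Zin X)"
  unfolding zin_mul_eq lin_ext_def using assms
  by (intro pm.subspace_sum[OF subspace_Zin] pm.subspace_scale[OF subspace_Zin] zin_word_in_Zin)
    (auto simp: carr_Zin)

theorem zinbiel_Zin: "zinbiel (Zin X :: ('k::field, 'x list \<Rightarrow>\<^sub>0 'k) alg)"
  unfolding zinbiel_def is_algebra_def
  by (auto simp: vector_space_pm_scale subspace_Zin zin_mul_in_Zin zin_mul_add_left zin_mul_add_right
      zin_mul_scale_left zin_mul_scale_right)
    (auto simp: carr_Zin intro!: zin_mul_zinbiel[simplified zin_mul_add_left])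

definition word_eval :: "('k, 'v) alg \<Rightarrow> ('x \<Rightarrow> 'v) \<Rightarrow> 'x list \<Rightarrow> 'v" where
  "word_eval A f w = foldl (mul A) (f (hd w)) (map f (tl w))"

definition zin_extend :: "('k::field, 'v::ab_group_add) alg \<Rightarrow> ('x \<Rightarrow> 'v) \<Rightarrow> ('x list \<Rightarrow>\<^sub>0 'k) \<Rightarrow> 'v" where
  "zin_extend A f = lin_ext (scl A) (word_eval A f)"

context
  fixes A :: "('k::field, 'v::ab_group_add) alg" and f :: "'x \<Rightarrow> 'v" and X :: "'x set"
  assumes zinb: "zinbiel A" and f: "f ` X \<subseteq> carr A"
begin

interpretation A: vector_space "scl A"
  using zinb by (simp add: zinbiel_def is_algebra_def)

private lemma sub: "A.subspace (carr A)"
  using zinb by (simp add: zinbiel_def is_algebra_def)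

private lemma mul_rules:
  "a \<in> carr A \<Longrightarrow> b \<in> carr A \<Longrightarrow> mul A a b \<in> carr A"
  "a \<in> carr A \<Longrightarrow> b \<in> carr A \<Longrightarrow> c \<in> carr A \<Longrightarrow> mul A (a + b) c = mul A a c + mul A b c"
  "a \<in> carr A \<Longrightarrow> b \<in> carr A \<Longrightarrow> c \<in> carr A \<Longrightarrow> mul A a (b + c) = mul A a b + mul A a c"
  "a \<in> carr A \<Longrightarrow> b \<in> carr A \<Longrightarrow> mul A (scl A r a) b = scl A r (mul A a b)"
  "a \<in> carr A \<Longrightarrow> b \<in> carr A \<Longrightarrow> mul A a (scl A r b) = scl A r (mul A a b)"
  "a \<in> carr A \<Longrightarrow> b \<in> carr A \<Longrightarrow> c \<in> carr A \<Longrightarrow>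
     mul A a (mul A b c) = mul A (mul A a b + mul A b a) c"
  using zinb unfolding zinbiel_def is_algebra_def by blast+

private lemma mul_zero: "a \<in> carr A \<Longrightarrow> mul A 0 a = 0" "a \<in> carr A \<Longrightarrow> mul A a 0 = 0"
  using mul_rules(2)[of 0 0 a] mul_rules(3)[of a 0 0] A.subspace_0[OF sub] by auto

private lemma eval_single: "word_eval A f [x] = f x"
  by (simp add: word_eval_def)

private lemma eval_snoc: "w \<noteq> [] \<Longrightarrow> word_eval A f (w @ [x]) = mul A (word_eval A f w) (f x)"
  by (simp add: word_eval_def)

private lemma eval_in: "w \<noteq> [] \<Longrightarrow> set w \<subseteq> X \<Longrightarrow> word_eval A f w \<in> carr A"
proof (induction w rule: rev_induct)
  case (snoc x w)
  then show ?case using f by (cases "w = []") (auto simp: eval_single eval_snoc intro!: mul_rules)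
qed simp

private lemma eval_sum_mul:
  assumes "x \<in> X" "\<And>w. w \<in># M \<Longrightarrow> w \<noteq> [] \<and> set w \<subseteq> X"
  shows "(\<Sum>w\<in>#M. word_eval A f w) \<in> carr A \<and>
     (\<Sum>w\<in>#M. word_eval A f (w @ [x])) = mul A (\<Sum>w\<in>#M. word_eval A f w) (f x)"
  using assms(2)
proof (induction M)
  case empty
  then show ?case using f assms(1) by (auto simp: mul_zero A.subspace_0[OF sub])
next
  case (add w M)
  then have IH: "(\<Sum>w\<in>#M. word_eval A f w) \<in> carr A"
    "(\<Sum>w\<in>#M. word_eval A f (w @ [x])) = mul A (\<Sum>w\<in>#M. word_eval A f w) (f x)"
    by auto
  have "w \<noteq> []" "word_eval A f w \<in> carr A" "f x \<in> carr A"
    using add.prems[of w] f assms(1) by (auto intro: eval_in)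
  with IH show ?case by (simp add: eval_snoc mul_rules(2) A.subspace_add[OF sub])
qed

private lemma eval_half_shuffle:
  assumes "u \<noteq> []" "v \<noteq> []" "set u \<subseteq> X" "set v \<subseteq> X"
  shows "(\<Sum>w\<in>#shuffle u (butlast v). word_eval A f (w @ [last v])) =
         mul A (word_eval A f u) (word_eval A f v)"
  using assms
proof (induction "length u + length v" arbitrary: u v rule: less_induct)
  case less
  obtain v' x where v: "v = v' @ [x]" using less.prems by (metis rev_exhaust)
  have x: "x \<in> X" "f x \<in> carr A" using less.prems v f by auto
  show ?case
  proof (cases "v' = []")
    case True
    then show ?thesis using less.prems by (simp add: v eval_single eval_snoc)
  next
    case False
    have v': "set v' \<subseteq> X" using less.prems v by auto
    have "(\<Sum>w\<in>#shuffle u v'. word_eval A f w) =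
        mul A (word_eval A f u) (word_eval A f v') + mul A (word_eval A f v') (word_eval A f u)"
      using less.hyps[of u v'] less.hyps[of v' u] less.prems False v'
      by (subst shuffle_eq_half_shuffles) (simp_all add: v image_mset.compositionality o_def)
    moreover have "(\<Sum>w\<in>#shuffle u v'. word_eval A f (w @ [x])) =
        mul A (\<Sum>w\<in>#shuffle u v'. word_eval A f w) (f x)"
      by (rule conjunct2[OF eval_sum_mul]) (use x less.prems v' in \<open>auto dest!: set_shuffle\<close>)
    moreover have "mul A (word_eval A f u) (mul A (word_eval A f v') (f x)) =
        mul A (mul A (word_eval A f u) (word_eval A f v') + mul A (word_eval A f v') (word_eval A f u)) (f x)"
      by (rule mul_rules(6)) (use less.prems False v' x in \<open>auto intro: eval_in\<close>)
    ultimately show ?thesis using False by (simp add: v eval_snoc)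
  qed
qed

private lemma extend_word_sum: "zin_extend A f (word_sum M) = (\<Sum>w\<in>#M. word_eval A f w)"
  by (induction M) (auto simp: zin_extend_def A.lin_ext_add A.lin_ext_single lin_ext_def[of _ _ 0])

private lemma extend_zero: "zin_extend A f 0 = 0"
  by (simp add: zin_extend_def lin_ext_def)

private lemma extend_in: "p \<in> carr (Zin X) \<Longrightarrow> zin_extend A f p \<in> carr A"
  unfolding zin_extend_def lin_ext_def
  by (intro A.subspace_sum[OF sub] A.subspace_scale[OF sub] eval_in) (auto simp: carr_Zin)

private lemma extend_mul:
  assumes "p \<in> carr (Zin X)" "q \<in> carr (Zin X)"
  shows "zin_extend A f (zin_mul p q) = mul A (zin_extend A f p) (zin_extend A f q)"
  using assms(1) unfolding carr_Zin
proof (induction p rule: pm_induct)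
  case zero
  then show ?case using assms by (simp add: extend_zero mul_zero extend_in)
next
  case (add p p')
  then show ?case
    using mul_rules(2)[OF extend_in extend_in extend_in, of p p' q] assms
    by (simp add: carr_Zin zin_mul_add_left zin_extend_def A.lin_ext_add)
next
  case (single u a)
  note u = single
  then have uin: "Poly_Mapping.single u a \<in> carr (Zin X)" by (simp add: carr_Zin)
  show ?case using assms(2) unfolding carr_Zin
  proof (induction q rule: pm_induct)
    case zero
    show ?case using uin by (simp add: extend_zero mul_zero extend_in)
  next
    case (add q q')
    then show ?case
      using mul_rules(3)[OF extend_in extend_in extend_in, of "Poly_Mapping.single u a" q q'] uin
      by (simp add: carr_Zin zin_mul_add_right zin_extend_def A.lin_ext_add)
  next
    case (single v b)
    have s: "zin_extend A f (Poly_Mapping.single w c) = scl A c (word_eval A f w)" for w c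
      by (simp add: zin_extend_def A.lin_ext_single)
    have "zin_extend A f (zin_word u v) = mul A (word_eval A f u) (word_eval A f v)"
      using eval_half_shuffle[of u v] u single
      by (simp add: zin_word_def extend_word_sum image_mset.compositionality o_def)
    moreover have "zin_extend A f (pm_scale c p) = scl A c (zin_extend A f p)" for c p
      by (simp add: zin_extend_def A.lin_ext_scale)
    moreover have "word_eval A f u \<in> carr A" "word_eval A f v \<in> carr A"
      using u single by (auto intro: eval_in)
    ultimately show ?case
      by (simp add: zin_mul_single s mul_rules(4,5) A.subspace_scale[OF sub])
  qed
qed

theorem Zin_extend:
  "alg_hom (zin_extend A f) (Zin X) A" "zin_extend A f (letter x) = f x"
  using extend_in extend_mul
  by (auto simp: alg_hom_def zin_extend_def A.lin_ext_add A.lin_ext_scale A.lin_ext_single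
      letter_def eval_single)

lemma linear_zin_extend: "Vector_Spaces.linear pm_scale (scl A) (zin_extend A f)"
  unfolding zin_extend_def by (rule A.linear_lin_ext)

theorem Zin_unique:
  assumes g: "alg_hom g (Zin X) A" "\<And>x. x \<in> X \<Longrightarrow> g (letter x) = f x" and p: "p \<in> carr (Zin X)"
  shows "g p = zin_extend A f p"
proof -
  have g_rules:
    "p \<in> carr (Zin X) \<Longrightarrow> q \<in> carr (Zin X) \<Longrightarrow> g (p + q) = g p + g q"
    "p \<in> carr (Zin X) \<Longrightarrow> g (pm_scale r p) = scl A r (g p)"
    "p \<in> carr (Zin X) \<Longrightarrow> q \<in> carr (Zin X) \<Longrightarrow> g (zin_mul p q) = mul A (g p) (g q)" for p q r
    using g(1) by (auto simp: alg_hom_def)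
  have z: "0 \<in> carr (Zin X)" by (simp add: carr_Zin)
  have w: "g (Poly_Mapping.single w 1) = word_eval A f w" if "w \<noteq> []" "set w \<subseteq> X" for w
    using that
  proof (induction w rule: rev_induct)
    case (snoc x w)
    show ?case
    proof (cases "w = []")
      case True
      then show ?thesis using g(2)[of x] snoc.prems by (simp add: eval_single letter_def)
    next
      case False
      have "Poly_Mapping.single (w @ [x]) (1::'k) = zin_mul (Poly_Mapping.single w 1) (letter x)"
        by (simp add: letter_def zin_mul_single zin_word_def)
      moreover have "Poly_Mapping.single w (1::'k) \<in> carr (Zin X)" using False snoc.prems by (simp add: carr_Zin)
      ultimately show ?thesis using False snoc g(2)[of x]
        by (simp add: g_rules(3) letter_in_Zin eval_snoc del: Zin_simps)
    qed
  qed simp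
  show ?thesis using p unfolding carr_Zin
  proof (induction p rule: pm_induct)
    case zero
    show ?case using g_rules(1)[OF z z] by (simp add: extend_zero)
  next
    case (add p q)
    then show ?case by (simp add: carr_Zin g_rules zin_extend_def A.lin_ext_add)
  next
    case (single u c)
    have "Poly_Mapping.single u 1 \<in> carr (Zin X)" using single by (simp add: carr_Zin)
    from g_rules(2)[OF this, of c] single w[of u] show ?case
      by (simp add: zin_extend_def A.lin_ext_single)
  qed
qed

end


section \<open>Speciality does not depend on the underlying type\<close>

theorem special_if_embeds:
  fixes B :: "('k::field, 'v::ab_group_add) alg" and C :: "('k, 'w::ab_group_add) alg"
  assumes B: "tortkara B" and C: "zinbiel C" and U: "subalgebra U (minus_algebra C)"
    and iso: "isomorphic B ((minus_algebra C)\<lparr>carr := U\<rparr>)"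
  shows "special B"
proof -
  obtain f where f: "alg_hom f B ((minus_algebra C)\<lparr>carr := U\<rparr>)" and bij: "bij_betw f (carr B) U"
    using iso by (auto simp: isomorphic_def)
  have UC: "U \<subseteq> carr C" using U by (simp add: subalgebra_def minus_algebra_def)
  have fC: "f ` carr B \<subseteq> carr C" using bij UC by (auto simp: bij_betw_def)
  define V where "V = carr (Zin (carr B) :: ('k, 'v list \<Rightarrow>\<^sub>0 'k) alg)"
  define F where "F = (zin_extend C f :: ('v list \<Rightarrow>\<^sub>0 'k) \<Rightarrow> 'w)"
  interpret C: vector_space "scl C" using C by (simp add: zinbiel_def is_algebra_def)
  interpret VP: vector_space_pair "pm_scale :: 'k \<Rightarrow> ('v list \<Rightarrow>\<^sub>0 'k) \<Rightarrow> _" "scl C" ..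
  have linF: "Vector_Spaces.linear pm_scale (scl C) F"
    unfolding F_def by (rule linear_zin_extend[OF C fC])
  obtain g where g: "g ` UNIV \<subseteq> V" "Vector_Spaces.linear (scl C) pm_scale g" "\<forall>v\<in>F ` V. F (g v) = v"
    using VP.linear_exists_right_inverse_on[OF linF, of V] subspace_Zin unfolding V_def by blast
  interpret F: Vector_Spaces.linear pm_scale "scl C" F by (rule linF)
  interpret g: Vector_Spaces.linear "scl C" pm_scale g by (rule g(2))
  define A where "A = \<lparr>carr = g ` F ` V, scl = pm_scale, mul = \<lambda>p q. g (mul C (F p) (F q))\<rparr>"
  have subV: "pm.subspace V" unfolding V_def by (rule subspace_Zin)
  have subFV: "C.subspace (F ` V)" by (rule F.subspace_image[OF subV])
  have hom: "alg_hom F (Zin (carr B)) C" unfolding F_def by (rule Zin_extend[OF C fC])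
  have Fg: "F (g a) = a" if "a \<in> F ` V" for a using g(3) that by blast
  have FVC: "a \<in> carr C" if "a \<in> F ` V" for a using hom that by (auto simp: V_def alg_hom_def)
  have mulFV: "mul C a b \<in> F ` V" if ab: "a \<in> F ` V" "b \<in> F ` V" for a b
  proof -
    obtain p q where "p \<in> V" "q \<in> V" "a = F p" "b = F q" using ab by blast
    then have "mul C a b = F (zin_mul p q)" "zin_mul p q \<in> V"
      using hom by (auto simp: alg_hom_def V_def zin_mul_in_Zin)
    then show ?thesis by blast
  qed
  have C_rules:
    "a \<in> carr C \<Longrightarrow> b \<in> carr C \<Longrightarrow> c \<in> carr C \<Longrightarrow> mul C (a + b) c = mul C a c + mul C b c"
    "a \<in> carr C \<Longrightarrow> b \<in> carr C \<Longrightarrow> c \<in> carr C \<Longrightarrow> mul C a (b + c) = mul C a b + mul C a c"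
    "a \<in> carr C \<Longrightarrow> b \<in> carr C \<Longrightarrow> mul C (scl C r a) b = scl C r (mul C a b)"
    "a \<in> carr C \<Longrightarrow> b \<in> carr C \<Longrightarrow> mul C a (scl C r b) = scl C r (mul C a b)"
    "a \<in> carr C \<Longrightarrow> b \<in> carr C \<Longrightarrow> c \<in> carr C \<Longrightarrow>
       mul C a (mul C b c) = mul C (mul C a b + mul C b a) c" for a b c r
    using C unfolding zinbiel_def is_algebra_def by blast+
  have "zinbiel A"
    unfolding zinbiel_def is_algebra_def
  proof (intro conjI allI ballI)
    show "vector_space (scl A)" by (simp add: A_def vector_space_pm_scale)
    show "module.subspace (scl A) (carr A)" using g.subspace_image[OF subFV] by (simp add: A_def)
    have AE: "\<exists>u. u \<in> F ` V \<and> a = g u" if "a \<in> carr A" for a using that by (auto simp: A_def)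
    fix r a b assume "a \<in> carr A" "b \<in> carr A"
    then obtain u v where uv: "u \<in> F ` V" "v \<in> F ` V" "a = g u" "b = g v" using AE by meson
    note uvC = uv(1,2)[THEN FVC]
    show "mul A a b \<in> carr A" using mulFV[OF uv(1,2)] uv by (simp add: A_def Fg)
    show "mul A (scl A r a) b = scl A r (mul A a b)" "mul A a (scl A r b) = scl A r (mul A a b)"
      using uv uvC by (simp_all add: A_def Fg F.scale g.scale C_rules(3,4))
    fix c assume "c \<in> carr A"
    then obtain w where w: "w \<in> F ` V" "c = g w" using AE by meson
    note wC = w(1)[THEN FVC]
    show "mul A (a + b) c = mul A a c + mul A b c" "mul A a (b + c) = mul A a b + mul A a c"
      using uv uvC w wC by (simp_all add: A_def Fg F.add g.add C_rules(1,2))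
    show "mul A a (mul A b c) = mul A (mul A a b + mul A b a) c"
      using uv uvC w wC by (simp add: A_def Fg F.add mulFV C_rules(5))
  qed
  moreover have fFV: "f b \<in> F ` V" if "b \<in> carr B" for b
    using Zin_extend(2)[OF C fC, of b] letter_in_Zin[OF that] unfolding F_def V_def by (metis imageI)
  have UFV: "a \<in> F ` V" if "a \<in> U" for a using bij fFV that by (auto simp: bij_betw_def)
  have subU: "C.subspace U" using U by (simp add: subalgebra_def minus_algebra_def)
  have "subalgebra (g ` U) (minus_algebra A)"
    unfolding subalgebra_def
  proof (intro conjI ballI)
    show "g ` U \<subseteq> carr (minus_algebra A)" using UFV by (auto simp: minus_algebra_def A_def)
    show "module.subspace (scl (minus_algebra A)) (g ` U)"
      using g.subspace_image[OF subU] by (simp add: minus_algebra_def A_def)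
    fix a b assume "a \<in> g ` U" "b \<in> g ` U"
    then obtain u v where uv: "u \<in> U" "v \<in> U" "a = g u" "b = g v" by blast
    then have "mul C u v - mul C v u \<in> U" using U by (auto simp: subalgebra_def minus_algebra_def)
    then have "g (mul C u v - mul C v u) \<in> g ` U" by blast
    then show "mul (minus_algebra A) a b \<in> g ` U"
      using uv by (simp add: minus_algebra_def A_def Fg UFV g.diff)
  qed
  moreover have "isomorphic B ((minus_algebra A)\<lparr>carr := g ` U\<rparr>)"
    unfolding isomorphic_def
  proof (intro exI conjI)
    show "alg_hom (g \<circ> f) B ((minus_algebra A)\<lparr>carr := g ` U\<rparr>)"
      using f by (auto simp: alg_hom_def minus_algebra_def A_def g.add g.scale g.diff Fg fFV)
    have "inj_on g U" by (rule inj_on_inverseI[of _ F]) (simp add: Fg UFV)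
    then have "bij_betw g U (g ` U)" by (simp add: bij_betw_def)
    then show "bij_betw (g \<circ> f) (carr B) (carr ((minus_algebra A)\<lparr>carr := g ` U\<rparr>))"
      using bij by (auto intro: bij_betw_trans)
  qed
  ultimately show ?thesis using B unfolding special_def by blast
qed

end

(*
  Write R_z for right multiplication of words by a letter z, and br u = u[x,y]. In two generators
  ST is spanned by x, y and all br u. Let I be an ideal of ST and J the right ideal of the free
  associative algebra that it generates. Since [z, i] = z \<squnion> i - 2 i z for i in I, J is stable under
  shuffling with letters and with the elements of ST, hence under shuffling with everything, so J is
  an ideal of the Zinbiel algebra. It meets ST only in I: br maps J into I, and an element of J in ST
  is br u modulo I with R_x u and R_y u in J. If I has no element with linear part a nonzero multiple
  of y (or none with x), then u itself lies in J. Otherwise x and y are fixed, modulo J, by a matrix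
  of left multiplications, and a Cayley-Hamilton argument gives J = Zin and then I = ST. Hence ST/I
  embeds into Zin/J.

  In three generators, a Zinbiel algebra in which [x,[x,y]], [x,[z,x]], [y,[z,x]] and [z,[x,y]] vanish
  also satisfies [[z,x],[x,y]] = 0, whereas an explicit 8-dimensional quotient of ST satisfies the
  former relations but not the latter.
*)
theory Submission
  imports Defs
begin

section \<open>The shuffle product and right derivatives\<close>

text \<open>Brackets never yield a right multiplication alone. In
  \<open>[z, u[x, y]] = (z \<squnion> u + u z)[x, y]\<close> and in
  \<open>[z, i] = z \<squnion> i - 2 i z\<close> it comes tied to a shuffle. The lemma
  \<open>absorb\<close> unties the two: a subspace that contains \<open>I\<close> and the elements
  \<open>z \<squnion> j + c j z\<close> with \<open>c > 0\<close> also contains the products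
  \<open>j z\<close>. It drives the inductions over \<open>J\<close> and, with the constants in
  place of \<open>I\<close>, those over all polynomials. The first formula is special to two
  generators: for a third letter \<open>z\<close> the term \<open>u z [x, y]\<close> gives way to
  \<open>u x [z, y] - u y [z, x]\<close>, and the result is no longer of the form
  \<open>v[x, y]\<close>. The case distinction on linear parts comes from cancelling a last letter.
  From \<open>u y\<close> in \<open>J\<close> one wants \<open>u\<close> in \<open>J\<close>, and
  the argument only stops at an element \<open>\<beta> y + v[x, y]\<close> of \<open>I\<close> with
  \<open>\<beta> \<noteq> 0\<close>. If such elements exist for both letters, the generators of the
  quotient are sums of brackets, and it has to be shown that such a quotient is zero.\<close>

abbreviation (input) pm_linear where
  "pm_linear \<equiv> Vector_Spaces.linear pm_scale pm_scale"

lemma pm_linear_eqI: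
  fixes f g :: "('a \<Rightarrow>\<^sub>0 'k::field) \<Rightarrow> ('b \<Rightarrow>\<^sub>0 'k)"
  assumes f: "pm_linear f" and g: "pm_linear g"
    and eq: "\<And>w. f (Poly_Mapping.single w 1) = g (Poly_Mapping.single w 1)"
  shows "f p = g p"
proof -
  interpret f: Vector_Spaces.linear pm_scale pm_scale f by (rule f)
  interpret g: Vector_Spaces.linear pm_scale pm_scale g by (rule g)
  have "\<forall>w\<in>Poly_Mapping.keys p. w \<in> UNIV" by simp
  then show ?thesis
  proof (induction p rule: pm_induct)
    case (single w c)
    have "Poly_Mapping.single w c = pm_scale c (Poly_Mapping.single w (1::'k))" by simp
    then show ?case using eq[of w] by (metis f.scale g.scale)
  qed (simp_all add: f.add g.add)
qed

lemma pm_linearI: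
  fixes f :: "('a \<Rightarrow>\<^sub>0 'k::field) \<Rightarrow> ('b \<Rightarrow>\<^sub>0 'k)"
  assumes "\<And>p q. f (p + q) = f p + f q" "\<And>c p. f (pm_scale c p) = pm_scale c (f p)"
  shows "pm_linear f"
  by (intro Vector_Spaces.linear.intro module_hom.intro vector_space_pm_scale
        module_hom_axioms.intro assms)
    (auto simp: module_iff_vector_space vector_space_pm_scale)

lemma pm_linearD:
  fixes f :: "('a \<Rightarrow>\<^sub>0 'k::field) \<Rightarrow> ('b \<Rightarrow>\<^sub>0 'k)"
  assumes "pm_linear f"
  shows "f (p + q) = f p + f q" "f (p - q) = f p - f q" "f (- p) = - f p" "f 0 = 0"
    "f (pm_scale c p) = pm_scale c (f p)"
proof -
  interpret f: Vector_Spaces.linear pm_scale pm_scale f by (rule assms)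
  show "f (p + q) = f p + f q" "f (p - q) = f p - f q" "f (- p) = - f p" "f 0 = 0"
    "f (pm_scale c p) = pm_scale c (f p)"
    by (simp_all add: f.add f.diff f.neg f.scale)
qed

definition rmul :: "'x \<Rightarrow> ('x list \<Rightarrow>\<^sub>0 'k::field) \<Rightarrow> 'x list \<Rightarrow>\<^sub>0 'k" where
  "rmul a = lin_ext pm_scale (\<lambda>w. Poly_Mapping.single (w @ [a]) 1)"

text \<open>Keeps the words that end in \<open>a\<close> and strips this letter.
  \<open>map_key\<close> is meaningful because appending \<open>a\<close> is injective.\<close>

definition rder :: "'x \<Rightarrow> ('x list \<Rightarrow>\<^sub>0 'k::field) \<Rightarrow> 'x list \<Rightarrow>\<^sub>0 'k" where
  "rder a p = Poly_Mapping.map_key (\<lambda>w. w @ [a]) p"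

text \<open>The shuffle product on all polynomials, commutative and associative, with the empty word
  as unit. The Zinbiel product is half of it, see \<open>zin_mul_symm\<close>.\<close>

definition shp :: "('x list \<Rightarrow>\<^sub>0 'k::field) \<Rightarrow> ('x list \<Rightarrow>\<^sub>0 'k) \<Rightarrow> 'x list \<Rightarrow>\<^sub>0 'k" where
  "shp p q = lin_ext pm_scale (\<lambda>u. lin_ext pm_scale (\<lambda>v. word_sum (shuffle u v)) q) p"

abbreviation pm_one :: "'x list \<Rightarrow>\<^sub>0 'k::field" where
  "pm_one \<equiv> Poly_Mapping.single [] 1"

lemma lookup_rder [simp]: "Poly_Mapping.lookup (rder a p) w = Poly_Mapping.lookup p (w @ [a])"
  unfolding rder_def by (subst Poly_Mapping.map_key.rep_eq) (auto simp: inj_def)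

lemma linear_rder: "pm_linear (rder a :: ('x list \<Rightarrow>\<^sub>0 'k::field) \<Rightarrow> _)"
  by (rule pm_linearI) (auto intro!: poly_mapping_eqI simp: lookup_add)

lemma linear_rmul: "pm_linear (rmul a :: ('x list \<Rightarrow>\<^sub>0 'k::field) \<Rightarrow> _)"
  unfolding rmul_def by (rule pm.linear_lin_ext)

lemma linear_shp_left: "pm_linear (\<lambda>p. shp p q)"
  unfolding shp_def by (rule pm.linear_lin_ext)

lemma linear_shp_right: "pm_linear (shp p)"
  unfolding shp_def
  by (rule pm_linearI)
    (auto simp: pm.lin_ext_add pm.lin_ext_scale lin_ext_def[of _ _ p] pm.scale_right_distrib
      sum.distrib pm.scale_sum_right ac_simps)

lemma linear_zin_mul_left: "pm_linear (\<lambda>p. zin_mul p q)"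
  and linear_zin_mul_right: "pm_linear (zin_mul p)"
  by (rule pm_linearI; simp add: zin_mul_add_left zin_mul_add_right zin_mul_scale_left zin_mul_scale_right)+

lemmas pm_op_linear [simp] =
  pm_linearD[OF linear_rder] pm_linearD[OF linear_rmul]
  pm_linearD[OF linear_shp_left] pm_linearD[OF linear_shp_right]
  pm_linearD[OF linear_zin_mul_left] pm_linearD[OF linear_zin_mul_right]

lemma linear_comp:
  "pm_linear f \<Longrightarrow> pm_linear g \<Longrightarrow> pm_linear (\<lambda>p. f (g p))"
  by (rule pm_linearI) (simp_all add: pm_linearD)

lemma linear_add:
  "pm_linear f \<Longrightarrow> pm_linear g \<Longrightarrow> pm_linear (\<lambda>p. f p + g p)"
  by (rule pm_linearI) (simp_all add: pm_linearD pm.scale_right_distrib)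

lemma linear_ident: "pm_linear (\<lambda>p. p)"
  by (rule pm_linearI) simp_all

lemmas pm_linear_intros = linear_ident
  linear_comp[OF linear_rder] linear_comp[OF linear_rmul] linear_comp[OF linear_shp_left]
  linear_comp[OF linear_shp_right] linear_comp[OF linear_zin_mul_left]
  linear_comp[OF linear_zin_mul_right] linear_add

lemma rmul_single [simp]: "rmul a (Poly_Mapping.single w c) = Poly_Mapping.single (w @ [a]) c"
  by (simp add: rmul_def pm.lin_ext_single)

lemma rmul_one: "rmul a pm_one = letter a"
  by (simp add: letter_def)

lemma shp_single: "shp (Poly_Mapping.single u 1) (Poly_Mapping.single v 1) = word_sum (shuffle u v)"
  by (simp add: shp_def pm.lin_ext_single)

lemma rder_single_snoc [simp]:
  "rder a (Poly_Mapping.single (w @ [b]) c) = (if a = b then Poly_Mapping.single w c else 0)"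
  "rder a (Poly_Mapping.single [] c) = 0"
  by (auto intro!: poly_mapping_eqI simp: lookup_single when_def)

lemma rder_rmul [simp]: "rder a (rmul b p) = (if a = b then p else 0)"
proof -
  have "rder a (rmul b p) = pm_scale (if a = b then 1 else 0) p"
    by (rule pm_linear_eqI[OF _ _, of "\<lambda>p. rder a (rmul b p)"])
      (auto intro!: pm_linear_intros pm_linearI simp: pm.scale_right_distrib ac_simps)
  then show ?thesis by simp
qed

lemma rmul_word_sum: "rmul a (word_sum M) = word_sum (image_mset (\<lambda>w. w @ [a]) M)"
  by (induction M) auto

lemma word_sum_add [simp]: "word_sum (M + N) = word_sum M + word_sum N"
  by (induction M) (auto simp: ac_simps)

lemma shp_commute: "shp p q = shp q p"
proof (rule pm_linear_eqI[of "\<lambda>p. shp p q" "\<lambda>p. shp q p"])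
  fix u
  show "shp (Poly_Mapping.single u 1) q = shp q (Poly_Mapping.single u 1)"
    by (rule pm_linear_eqI[of "\<lambda>q. shp (Poly_Mapping.single u 1) q"])
      (auto intro!: pm_linear_intros simp: shp_single shuffle_commute)
qed (auto intro!: pm_linear_intros)

lemma shp_single_sum:
  "shp (Poly_Mapping.single u 1) (word_sum M) = word_sum (\<Sum>s\<in>#M. shuffle u s)"
  "shp (word_sum M) (Poly_Mapping.single u 1) = word_sum (\<Sum>s\<in>#M. shuffle s u)"
  by (induction M) (auto simp: shp_single)

lemma shp_assoc: "shp (shp p q) r = shp p (shp q r)"
proof (rule pm_linear_eqI[of "\<lambda>p. shp (shp p q) r"])
  fix u
  let ?u = "Poly_Mapping.single u 1 :: 'a list \<Rightarrow>\<^sub>0 'b"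
  show "shp (shp ?u q) r = shp ?u (shp q r)"
  proof (rule pm_linear_eqI[of "\<lambda>q. shp (shp ?u q) r"])
    fix v
    let ?v = "Poly_Mapping.single v 1 :: 'a list \<Rightarrow>\<^sub>0 'b"
    show "shp (shp ?u ?v) r = shp ?u (shp ?v r)"
      by (rule pm_linear_eqI[of "shp (shp ?u ?v)"])
        (auto intro!: pm_linear_intros simp: shp_single shp_single_sum shuffle_assoc)
  qed (auto intro!: pm_linear_intros)
qed (auto intro!: pm_linear_intros)

lemma shp_left_commute: "shp p (shp q r) = shp q (shp p r)"
  by (metis shp_assoc shp_commute)

lemma shp_one [simp]: "shp pm_one p = p" "shp p pm_one = p"
proof -
  show "shp pm_one p = p"
    by (rule pm_linear_eqI[of "shp pm_one" "\<lambda>p. p"])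
      (auto intro!: pm_linear_intros pm_linearI simp: shp_single)
  then show "shp p pm_one = p" by (simp add: shp_commute)
qed

lemma shp_rmul_rmul:
  "shp (rmul a p) (rmul b q) = rmul a (shp p (rmul b q)) + rmul b (shp (rmul a p) q)"
proof (rule pm_linear_eqI[of "\<lambda>p. shp (rmul a p) (rmul b q)"])
  fix u
  let ?u = "Poly_Mapping.single u 1 :: 'a list \<Rightarrow>\<^sub>0 'b"
  show "shp (rmul a ?u) (rmul b q) = rmul a (shp ?u (rmul b q)) + rmul b (shp (rmul a ?u) q)"
    by (rule pm_linear_eqI[of "\<lambda>q. shp (rmul a ?u) (rmul b q)"])
      (auto intro!: pm_linear_intros simp del: rmul_single
        simp: rmul_single[where c=1] shp_single shuffle_snoc rmul_word_sum)
qed (auto intro!: pm_linear_intros)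

lemma shp_letter_rmul:
  "shp (letter a) (rmul b q) = rmul a (rmul b q) + rmul b (shp (letter a) q)"
  using shp_rmul_rmul[of a pm_one b q] by (simp add: letter_def)

lemma zin_mul_rmul: "zin_mul p (rmul a q) = rmul a (shp p q)"
proof (rule pm_linear_eqI[of "\<lambda>p. zin_mul p (rmul a q)"])
  fix u
  let ?u = "Poly_Mapping.single u 1 :: 'a list \<Rightarrow>\<^sub>0 'b"
  show "zin_mul ?u (rmul a q) = rmul a (shp ?u q)"
    by (rule pm_linear_eqI[of "\<lambda>q. zin_mul ?u (rmul a q)"])
      (auto intro!: pm_linear_intros simp: shp_single zin_mul_single zin_word_def rmul_word_sum)
qed (auto intro!: pm_linear_intros)

lemma zin_mul_letter: "zin_mul p (letter a) = rmul a p"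
  using zin_mul_rmul[of p a pm_one] by (simp add: letter_def)

lemma lookup_rmul [simp]:
  "Poly_Mapping.lookup (rmul a p) [] = 0"
  "Poly_Mapping.lookup (rmul a p) (w @ [b]) = (if a = b then Poly_Mapping.lookup p w else 0)"
proof -
  have "Poly_Mapping.lookup (rder b (rmul a p)) w = (if a = b then Poly_Mapping.lookup p w else 0)"
    by simp
  then show "Poly_Mapping.lookup (rmul a p) (w @ [b]) = (if a = b then Poly_Mapping.lookup p w else 0)"
    unfolding lookup_rder .
  have "\<forall>w\<in>Poly_Mapping.keys p. w \<in> UNIV" by simp
  then show "Poly_Mapping.lookup (rmul a p) [] = 0"
    by (induction p rule: pm_induct) (auto simp: lookup_add lookup_single)
qed

section \<open>Linear combinations of words over an alphabet, the empty word included\<close>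

definition polys :: "'x set \<Rightarrow> ('x list \<Rightarrow>\<^sub>0 'k::field) set" where
  "polys X = {p. \<forall>w\<in>Poly_Mapping.keys p. w \<in> lists X}"

lemma subspace_polys: "pm.subspace (polys X :: ('x list \<Rightarrow>\<^sub>0 'k::field) set)"
proof (rule pm.subspaceI)
  fix p q :: "'x list \<Rightarrow>\<^sub>0 'k" assume "p \<in> polys X" "q \<in> polys X"
  then show "p + q \<in> polys X"
    using Poly_Mapping.keys_add[of p q] unfolding polys_def by blast
qed (auto simp: polys_def in_keys_iff)

lemma carr_Zin_polys:
  "p \<in> carr (Zin X) \<longleftrightarrow> p \<in> polys X \<and> Poly_Mapping.lookup p [] = 0"
  unfolding carr_Zin polys_def by (auto simp: in_keys_iff subset_iff)

lemma rmul_in_polys: 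
  assumes "p \<in> polys X" "a \<in> X" shows "rmul a p \<in> polys X"
  unfolding polys_def
proof (intro CollectI ballI)
  fix w assume w: "w \<in> Poly_Mapping.keys (rmul a p)"
  show "w \<in> lists X"
  proof (cases w rule: rev_cases)
    case (snoc v b)
    then show ?thesis using w assms unfolding polys_def
      by (auto simp: in_keys_iff split: if_splits)
  qed simp
qed

lemma rder_in_polys: "p \<in> polys X \<Longrightarrow> rder a p \<in> polys X"
  unfolding polys_def by (force simp: in_keys_iff dest!: bspec[of _ _ "_ @ [a]"])

lemma one_in_polys: "pm_one \<in> polys X"
  by (simp add: polys_def)

lemma polys_induct [consumes 1, case_names one add scale rmul]:
  fixes P :: "('x list \<Rightarrow>\<^sub>0 'k::field) \<Rightarrow> bool"
  assumes p: "p \<in> polys X"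
    and one: "P pm_one" and add: "\<And>p q. \<lbrakk>p \<in> polys X; q \<in> polys X; P p; P q\<rbrakk> \<Longrightarrow> P (p + q)"
    and scale: "\<And>c p. \<lbrakk>p \<in> polys X; P p\<rbrakk> \<Longrightarrow> P (pm_scale c p)"
    and rmul: "\<And>a p. \<lbrakk>p \<in> polys X; a \<in> X; P p\<rbrakk> \<Longrightarrow> P (rmul a p)"
  shows "P p"
  using p unfolding polys_def mem_Collect_eq
proof (induction p rule: pm_induct)
  case zero
  then show ?case using scale[OF one_in_polys one, of 0] by simp
next
  case (add p q)
  then show ?case using assms(3) unfolding polys_def by blast
next
  case (single w c)
  have "P (Poly_Mapping.single w 1) \<and> Poly_Mapping.single w (1::'k) \<in> polys X" using single
  proof (induction w rule: rev_induct)
    case (snoc a w)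
    then show ?case using rmul[of "Poly_Mapping.single w 1" a] by (simp add: polys_def)
  qed (use one one_in_polys in auto)
  then show ?case using scale[of "Poly_Mapping.single w 1" c] by simp
qed

lemma polys_expand:
  assumes "p \<in> polys {x, y}" "x \<noteq> y"
  shows "pm_scale (Poly_Mapping.lookup p []) pm_one + rmul x (rder x p) + rmul y (rder y p) = p"
  using assms(1)
proof (induction p rule: polys_induct)
  case (add p q)
  have "pm_scale (Poly_Mapping.lookup (p + q) []) pm_one + rmul x (rder x (p + q)) + rmul y (rder y (p + q)) =
     (pm_scale (Poly_Mapping.lookup p []) pm_one + rmul x (rder x p) + rmul y (rder y p)) +
     (pm_scale (Poly_Mapping.lookup q []) pm_one + rmul x (rder x q) + rmul y (rder y q))"
    by (simp only: lookup_add pm.scale_left_distrib pm_op_linear) (simp only: ac_simps)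
  then show ?case by (simp only: add.IH)
next
  case (scale c p)
  have "pm_scale (Poly_Mapping.lookup (pm_scale c p) []) pm_one + rmul x (rder x (pm_scale c p)) +
      rmul y (rder y (pm_scale c p)) =
     pm_scale c (pm_scale (Poly_Mapping.lookup p []) pm_one + rmul x (rder x p) + rmul y (rder y p))"
    by (simp only: lookup_pm_scale pm_op_linear pm.scale_right_distrib pm.scale_scale)
  then show ?case by (simp only: scale.IH)
qed (use assms(2) in auto)

lemma lookup_shp_Nil [simp]:
  "Poly_Mapping.lookup (shp p q) [] = Poly_Mapping.lookup p [] * Poly_Mapping.lookup q []"
proof -
  have s: "p \<in> polys UNIV" "q \<in> polys UNIV" by (simp_all add: polys_def)
  show ?thesis using s(1)
  proof (induction p rule: polys_induct)
    case (rmul a p)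
    show ?case using s(2)
      by (induction q rule: polys_induct) (auto simp: lookup_add lookup_single shp_rmul_rmul algebra_simps)
  qed (auto simp: lookup_add algebra_simps)
qed

text \<open>The last letter of a shuffle comes from one of the two factors, so stripping it is a
  derivation.\<close>

lemma rder_shp: "rder a (shp p q) = shp (rder a p) q + shp p (rder a q)"
proof -
  have s: "p \<in> polys UNIV" "q \<in> polys UNIV" by (simp_all add: polys_def)
  show ?thesis using s(1)
  proof (induction p rule: polys_induct)
    case (rmul b p)
    show ?case using s(2)
      by (induction q rule: polys_induct) (auto simp: shp_rmul_rmul pm.scale_right_distrib)
  qed (auto simp: pm.scale_right_distrib)
qed

lemma rder_zin_mul:
  assumes "Poly_Mapping.lookup q [] = 0"
  shows "rder a (zin_mul p q) = shp p (rder a q)"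
proof -
  have q: "q \<in> polys UNIV" by (simp add: polys_def)
  \<comment> \<open>In a half-shuffle the last letter comes from \<open>q\<close>. A constant term
    of \<open>q\<close> would append the unspecified letter \<open>last []\<close>; carrying its
    contribution along makes the claim linear in \<open>q\<close>, as the induction
    requires.\<close>
  have "rder a (zin_mul p q) = shp p (rder a q) +
      pm_scale (Poly_Mapping.lookup q []) (rder a (zin_mul p pm_one))" using q
    by (induction q rule: polys_induct)
      (auto simp: zin_mul_rmul lookup_add pm.scale_left_distrib pm.scale_right_distrib)
  then show ?thesis using assms by simp
qed

lemma zin_mul_symm:
  assumes "p \<in> carr (Zin X)" "q \<in> carr (Zin X)"
  shows "zin_mul p q + zin_mul q p = shp p q"
  using assms(1) unfolding carr_Zin
proof (induction p rule: pm_induct)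
  case (single u c)
  show ?case using assms(2) unfolding carr_Zin
  proof (induction q rule: pm_induct)
    case (single v d)
    define U V where UV: "U = Poly_Mapping.single u (1::'b)" "V = Poly_Mapping.single v (1::'b)"
    have eqs: "Poly_Mapping.single u c = pm_scale c U" "Poly_Mapping.single v d = pm_scale d V"
      by (simp_all add: UV)
    have "zin_mul U V + zin_mul V U = shp U V"
      using single \<open>u \<in> _\<close> unfolding UV
      by (simp add: zin_mul_single shp_single zin_word_def shuffle_eq_half_shuffles[of u v])
    then have "pm_scale (c * d) (zin_mul U V + zin_mul V U) = pm_scale (c * d) (shp U V)" by simp
    then show ?case
      unfolding eqs by (simp add: pm.scale_right_distrib ac_simps)
  qed (auto simp: algebra_simps)
qed (auto simp: algebra_simps)

lemma shp_in_polys: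
  assumes "p \<in> polys X" "q \<in> polys X" shows "shp p q \<in> polys X"
  using assms
proof (induction p arbitrary: q rule: polys_induct)
  case (rmul a p)
  from rmul.prems show ?case
  proof (induction q rule: polys_induct)
    case (rmul b q)
    then show ?case using \<open>p \<in> polys X\<close> \<open>a \<in> X\<close> rmul.IH \<open>\<And>q. q \<in> polys X \<Longrightarrow> shp p q \<in> polys X\<close>
      by (auto simp: shp_rmul_rmul intro!: pm.subspace_add[OF subspace_polys] rmul_in_polys)
  qed (use rmul in \<open>auto simp: rmul_in_polys intro!: pm.subspace_add[OF subspace_polys] pm.subspace_scale[OF subspace_polys]\<close>)
qed (auto intro!: pm.subspace_add[OF subspace_polys] pm.subspace_scale[OF subspace_polys])

lemma subspace_scaleD:
  fixes v :: "'a \<Rightarrow>\<^sub>0 'k::field"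
  assumes "pm.subspace M" "pm_scale r v \<in> M" "r \<noteq> 0"
  shows "v \<in> M"
  using pm.subspace_scale[OF assms(1,2), of "inverse r"] assms(3) by simp

section \<open>Right ideals of the free associative algebra\<close>

text \<open>
  Both uses are instances: the constants satisfy the last condition with \<open>d = 1\<close>, and an ideal of the
  free special Tortkara algebra with \<open>d = 2\<close>, because \<open>[z, i] = z \<squnion> i - 2 i z\<close>.
\<close>

locale right_filtration =
  fixes x y :: 'x and I :: "('x list \<Rightarrow>\<^sub>0 'k::field_char_0) set" and d :: nat
  assumes subspace_I: "pm.subspace I" and d_pos: "d > 0"
    and letter_I: "\<And>z i. z \<in> {x, y} \<Longrightarrow> i \<in> I \<Longrightarrow>
      shp (letter z) i - pm_scale (of_nat d) (rmul z i) \<in> I"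
begin

text \<open>Level \<open>n\<close> is \<open>I\<close> multiplied on the right by polynomials of
  degree at most \<open>n\<close>. The levels, and not only their union, are needed as induction
  parameters.\<close>

primrec rid :: "nat \<Rightarrow> ('x list \<Rightarrow>\<^sub>0 'k) set" where
  "rid 0 = I"
| "rid (Suc n) = {i + rmul x a + rmul y b | i a b. i \<in> I \<and> a \<in> rid n \<and> b \<in> rid n}"

definition J where "J = (\<Union>n. rid n)"

lemma subspace_rid: "pm.subspace (rid n)"
proof (induction n)
  case 0
  then show ?case by (simp add: subspace_I)
next
  case (Suc n)
  show ?case
  proof (rule pm.subspaceI)
    show "0 \<in> rid (Suc n)"
      using pm.subspace_0[OF Suc] pm.subspace_0[OF subspace_I] by force
    fix p q assume "p \<in> rid (Suc n)" "q \<in> rid (Suc n)"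
    then obtain i a b i' a' b' where
      *: "p = i + rmul x a + rmul y b" "i \<in> I" "a \<in> rid n" "b \<in> rid n"
        "q = i' + rmul x a' + rmul y b'" "i' \<in> I" "a' \<in> rid n" "b' \<in> rid n"
      by auto
    then have "p + q = (i + i') + rmul x (a + a') + rmul y (b + b')" by simp
    with * show "p + q \<in> rid (Suc n)"
      unfolding rid.simps using pm.subspace_add[OF Suc] pm.subspace_add[OF subspace_I] by blast
  next
    fix c p assume "p \<in> rid (Suc n)"
    then obtain i a b where
      *: "p = i + rmul x a + rmul y b" "i \<in> I" "a \<in> rid n" "b \<in> rid n"
      by auto
    then have "pm_scale c p = pm_scale c i + rmul x (pm_scale c a) + rmul y (pm_scale c b)"
      by (simp add: pm.scale_right_distrib)
    with * show "pm_scale c p \<in> rid (Suc n)"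
      unfolding rid.simps using pm.subspace_scale[OF Suc] pm.subspace_scale[OF subspace_I] by blast
  qed
qed

lemma I_rid: "i \<in> I \<Longrightarrow> i \<in> rid n"
proof (cases n)
  case (Suc m)
  assume "i \<in> I"
  then show ?thesis using pm.subspace_0[OF subspace_rid[of m]] Suc by force
qed simp

lemma rid_rmul: "a \<in> rid n \<Longrightarrow> z \<in> {x, y} \<Longrightarrow> rmul z a \<in> rid (Suc n)"
  using pm.subspace_0[OF subspace_rid[of n]] pm.subspace_0[OF subspace_I] by force

lemma rid_Suc_subset:
  assumes "pm.subspace M" "I \<subseteq> M" "\<And>z j. z \<in> {x, y} \<Longrightarrow> j \<in> rid n \<Longrightarrow> rmul z j \<in> M"
  shows "rid (Suc n) \<subseteq> M"
  using assms by (auto intro!: pm.subspace_add[OF assms(1)])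

declare rid.simps(2) [simp del]

lemma rid_mono_Suc: "rid n \<subseteq> rid (Suc n)"
proof (induction n)
  case 0
  then show ?case using I_rid[of _ 1] by auto
next
  case (Suc n)
  then show ?case
    by (intro rid_Suc_subset subspace_rid) (auto intro: I_rid rid_rmul)
qed

lemma rid_mono: "m \<le> n \<Longrightarrow> rid m \<subseteq> rid n"
  by (rule lift_Suc_mono_le[of rid]) (use rid_mono_Suc in auto)

lemma subspace_J: "pm.subspace J"
proof (rule pm.subspaceI)
  show "0 \<in> J" unfolding J_def using pm.subspace_0[OF subspace_rid] by auto
  fix p q assume "p \<in> J" "q \<in> J"
  then obtain m n where "p \<in> rid m" "q \<in> rid n" unfolding J_def by auto
  then have "p + q \<in> rid (max m n)"
    using rid_mono[of m "max m n"] rid_mono[of n "max m n"] by (intro pm.subspace_add[OF subspace_rid]) auto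
  then show "p + q \<in> J" unfolding J_def by auto
next
  fix c p assume "p \<in> J"
  then show "pm_scale c p \<in> J" unfolding J_def using pm.subspace_scale[OF subspace_rid] by auto
qed

lemma I_J: "i \<in> I \<Longrightarrow> i \<in> J"
  unfolding J_def using I_rid by blast

lemma rid_J: "j \<in> rid n \<Longrightarrow> j \<in> J"
  unfolding J_def by blast

lemma J_rmul: "j \<in> J \<Longrightarrow> z \<in> {x, y} \<Longrightarrow> rmul z j \<in> J"
  unfolding J_def using rid_rmul by blast

lemma J_subset:
  assumes M: "pm.subspace M" "I \<subseteq> M" "\<And>z j. z \<in> {x, y} \<Longrightarrow> j \<in> J \<Longrightarrow> j \<in> M \<Longrightarrow> rmul z j \<in> M"
  shows "J \<subseteq> M"
proof -
  have "rid n \<subseteq> M" for n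
  proof (induction n)
    case (Suc n)
    then show ?case using rid_J by (intro rid_Suc_subset M(1,2)) (auto intro!: M(3))
  qed (use M in simp)
  then show ?thesis unfolding J_def by auto
qed

lemma J_cases:
  assumes "j \<in> J"
  obtains i a b where "j = i + rmul x a + rmul y b" "i \<in> I" "a \<in> J" "b \<in> J"
proof -
  obtain n where "j \<in> rid (Suc n)" using assms rid_mono_Suc unfolding J_def by blast
  then show ?thesis using that rid_J by (auto simp: rid.simps(2))
qed

text \<open>On \<open>I\<close> the hypothesis \<open>letter_I\<close> expresses
  \<open>z \<squnion> i\<close> by \<open>I\<close> and \<open>i z\<close>; above,
  \<open>z \<squnion> (j a) = j a z + (z \<squnion> j) a\<close>. Exactly one level is lost, which
  is what the induction in \<open>absorb\<close> can afford.\<close>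

lemma rid_letter:
  assumes "j \<in> rid n" "z \<in> {x, y}"
  shows "shp (letter z) j \<in> rid (Suc n)"
  using assms(1)
proof (induction n arbitrary: j)
  case 0
  have "shp (letter z) j = (shp (letter z) j - pm_scale (of_nat d) (rmul z j)) + pm_scale (of_nat d) (rmul z j)"
    by simp
  also have "\<dots> \<in> rid (Suc 0)"
    using letter_I[OF assms(2), of j] 0 assms(2)
    by (intro pm.subspace_add[OF subspace_rid] pm.subspace_scale[OF subspace_rid] rid_rmul)
      (auto intro: I_rid)
  finally show ?case .
next
  case (Suc n)
  have sub: "pm.subspace {j. shp (letter z) j \<in> rid (Suc (Suc n))}"
    by (rule pm.subspaceI)
      (use subspace_rid in \<open>auto simp: pm.subspace_0 pm.subspace_add pm.subspace_scale\<close>)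
  have "rid (Suc n) \<subseteq> {j. shp (letter z) j \<in> rid (Suc (Suc n))}"
  proof (rule rid_Suc_subset[OF sub])
    show "I \<subseteq> {j. shp (letter z) j \<in> rid (Suc (Suc n))}"
      using Suc.IH I_rid rid_mono_Suc[of "Suc n"] by auto
    fix a j assume a: "a \<in> {x, y}" "j \<in> rid n"
    then show "rmul a j \<in> {j. shp (letter z) j \<in> rid (Suc (Suc n))}"
      using assms(2) Suc.IH[of j]
      by (auto simp: shp_letter_rmul
          intro!: pm.subspace_add[OF subspace_rid] rid_rmul)
  qed
  then show ?case using Suc.prems by blast
qed

lemma J_letter: "j \<in> J \<Longrightarrow> z \<in> {x, y} \<Longrightarrow> shp (letter z) j \<in> J"
  unfolding J_def using rid_letter by blast

text \<open>
  The induction replaces \<open>M\<close> by \<open>{j. z \<squnion> j \<in> M}\<close> and \<open>c\<close> by \<open>c + 1\<close>; it works because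
  \<open>z \<squnion> (a \<squnion> j + (c + 1) j a)\<close> equals \<open>(a \<squnion> (z \<squnion> j) + c (z \<squnion> j) a) + (z \<squnion> j a + c j a z)\<close>.
\<close>

lemma absorb:
  assumes "pm.subspace M" "I \<subseteq> M" "c > 0"
    and "\<And>z j. z \<in> {x, y} \<Longrightarrow> j \<in> rid n \<Longrightarrow> shp (letter z) j + pm_scale (of_nat c) (rmul z j) \<in> M"
  shows "rid (Suc n) \<subseteq> M"
  using assms
proof (induction n arbitrary: c M)
  case 0
  show ?case
  proof (rule rid_Suc_subset[OF 0(1,2)])
    fix z j assume z: "z \<in> {x, y}" "j \<in> rid 0"
    then have m: "shp (letter z) j - pm_scale (of_nat d) (rmul z j) \<in> M"
      using letter_I 0(2) by auto
    \<comment> \<open>For \<open>j\<close> in \<open>I\<close> there are two linear relations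
      between \<open>z \<squnion> j\<close> and \<open>j z\<close> modulo \<open>M\<close>, with
      determinant \<open>c + d\<close>, nonzero in characteristic 0.\<close>
    have "(shp (letter z) j + pm_scale (of_nat c) (rmul z j)) -
        (shp (letter z) j - pm_scale (of_nat d) (rmul z j)) = pm_scale (of_nat (c + d)) (rmul z j)"
      by (simp add: pm.scale_left_distrib)
    with pm.subspace_diff[OF 0(1) 0(4)[OF z] m] have "pm_scale (of_nat (c + d)) (rmul z j) \<in> M"
      by simp
    then show "rmul z j \<in> M" by (rule subspace_scaleD[OF 0(1)]) (use d_pos in \<open>simp del: of_nat_add\<close>)
  qed
next
  case (Suc n)
  note sub = Suc.prems(1)
  define M' where "M' = {j. \<forall>z\<in>{x, y}. shp (letter z) j \<in> M}"
  have sub': "pm.subspace M'" unfolding M'_def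
    by (rule pm.subspaceI)
      (auto simp: pm.subspace_0[OF sub] pm.subspace_add[OF sub] pm.subspace_scale[OF sub])
  have "rid (Suc n) \<subseteq> M'"
  proof (rule Suc.IH[of M' "Suc c"])
    show "I \<subseteq> M'"
    proof (unfold M'_def, intro subsetI CollectI ballI)
      fix i z assume i: "i \<in> I" and z: "z \<in> {x, y}"
      define s r where sr: "s = shp (letter z) i" "r = rmul z i"
      have m: "s - pm_scale (of_nat d) r \<in> M" "s + pm_scale (of_nat c) r \<in> M"
        using letter_I[OF z i] Suc.prems(2) Suc.prems(4)[OF z I_rid[OF i]] unfolding sr by auto
      \<comment> \<open>The same two relations, now solved for the shuffle.\<close>
      have "pm_scale (of_nat c) (s - pm_scale (of_nat d) r) +
          pm_scale (of_nat d) (s + pm_scale (of_nat c) r) = pm_scale (of_nat (c + d)) s"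
        by (rule poly_mapping_eqI) (simp add: lookup_add lookup_minus algebra_simps)
      with pm.subspace_add[OF sub pm.subspace_scale[OF sub m(1)] pm.subspace_scale[OF sub m(2)]]
      have "pm_scale (of_nat (c + d)) s \<in> M" by metis
      then show "shp (letter z) i \<in> M"
        unfolding sr by (rule subspace_scaleD[OF sub]) (use d_pos in \<open>simp del: of_nat_add\<close>)
    qed
    fix a j assume a: "a \<in> {x, y}" and j: "j \<in> rid n"
    show "shp (letter a) j + pm_scale (of_nat (Suc c)) (rmul a j) \<in> M'"
      unfolding M'_def
    proof (intro CollectI ballI)
      fix z assume z: "z \<in> {x, y}"
      have m: "shp (letter a) (shp (letter z) j) + pm_scale (of_nat c) (rmul a (shp (letter z) j)) \<in> M"
        "shp (letter z) (rmul a j) + pm_scale (of_nat c) (rmul z (rmul a j)) \<in> M"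
        by (intro Suc.prems(4) a z rid_letter rid_rmul j)+
      have "shp (letter z) (shp (letter a) j + pm_scale (of_nat (Suc c)) (rmul a j)) =
        (shp (letter a) (shp (letter z) j) + pm_scale (of_nat c) (rmul a (shp (letter z) j))) +
        (shp (letter z) (rmul a j) + pm_scale (of_nat c) (rmul z (rmul a j)))"
        by (rule poly_mapping_eqI)
          (simp add: lookup_add shp_letter_rmul shp_left_commute[of "letter a"] algebra_simps)
      then show "shp (letter z) (shp (letter a) j + pm_scale (of_nat (Suc c)) (rmul a j)) \<in> M"
        using pm.subspace_add[OF sub m] by simp
    qed
  qed (use sub' in auto)
  then have S: "shp (letter z) j \<in> M" if "z \<in> {x, y}" "j \<in> rid (Suc n)" for z j
    using that unfolding M'_def by blast
  show ?case
  proof (rule rid_Suc_subset[OF sub Suc.prems(2)])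
    fix z j assume z: "z \<in> {x, y}" "j \<in> rid (Suc n)"
    have "pm_scale (of_nat c) (rmul z j) \<in> M"
      using pm.subspace_diff[OF sub Suc.prems(4)[OF z] S[OF z]] by simp
    then show "rmul z j \<in> M" by (rule subspace_scaleD[OF sub]) (use Suc.prems(3) in simp)
  qed
qed

text \<open>An induction principle for \<open>J\<close>: since \<open>absorb\<close> climbs one
  level at a time, the closure condition may assume that \<open>j\<close> is already in
  \<open>M\<close>.\<close>

lemma absorb_J:
  assumes "pm.subspace M" "I \<subseteq> M" "c > 0"
    and step: "\<And>z j. z \<in> {x, y} \<Longrightarrow> j \<in> J \<Longrightarrow> j \<in> M \<Longrightarrow> shp (letter z) j + pm_scale (of_nat c) (rmul z j) \<in> M"
  shows "J \<subseteq> M"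
proof -
  have "rid n \<subseteq> M" for n
  proof (induction n)
    case (Suc n)
    show ?case by (rule absorb[OF assms(1-3)]) (use Suc rid_J in \<open>blast intro: step\<close>)
  qed (use assms in simp)
  then show ?thesis unfolding J_def by auto
qed

end

section \<open>All polynomials as the right ideal generated by the constants\<close>

definition constants :: "('x list \<Rightarrow>\<^sub>0 'k::field) set" where
  "constants = range (\<lambda>c. pm_scale c pm_one)"

lemma right_filtration_constants:
  "right_filtration x y (constants :: ('x list \<Rightarrow>\<^sub>0 'k::field_char_0) set) 1"
proof
  have "constants = pm.span {pm_one :: 'x list \<Rightarrow>\<^sub>0 'k}"
    by (simp add: constants_def pm.span_singleton)
  then show sub: "pm.subspace (constants :: ('x list \<Rightarrow>\<^sub>0 'k) set)" by (metis pm.subspace_span)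
  fix z and i :: "'x list \<Rightarrow>\<^sub>0 'k"
  assume "i \<in> constants"
  then have "shp (letter z) i - pm_scale (of_nat 1) (rmul z i) = 0"
    by (auto simp: constants_def letter_def simp del: pm_scale_single rmul_single)
       (simp)
  then show "shp (letter z) i - pm_scale (of_nat 1) (rmul z i) \<in> constants"
    using pm.subspace_0[OF sub] by simp
qed simp

lemma J_constants: "right_filtration.J x y constants = (polys {x, y} :: ('x list \<Rightarrow>\<^sub>0 'k::field_char_0) set)"
proof -
  interpret C: right_filtration x y "constants :: ('x list \<Rightarrow>\<^sub>0 'k) set" 1
    by (rule right_filtration_constants)
  have one: "pm_one \<in> (constants :: ('x list \<Rightarrow>\<^sub>0 'k) set)"
    unfolding constants_def by (rule range_eqI[of _ _ 1]) simp
  show ?thesis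
  proof
    show "C.J \<subseteq> polys {x, y}"
      by (rule C.J_subset[OF subspace_polys])
        (auto simp: constants_def simp del: pm_scale_single
          intro!: rmul_in_polys pm.subspace_scale[OF subspace_polys] one_in_polys)
    show "polys {x, y} \<subseteq> C.J"
    proof
      fix p :: "'x list \<Rightarrow>\<^sub>0 'k" assume "p \<in> polys {x, y}"
      then show "p \<in> C.J"
        by (induction p rule: polys_induct)
          (use C.subspace_J one in \<open>auto intro: C.I_J C.J_rmul pm.subspace_add pm.subspace_scale\<close>)
    qed
  qed
qed

section \<open>The commutator of the Zinbiel product and the elements \<open>u[x, y]\<close>\<close>

definition br :: "'x \<Rightarrow> 'x \<Rightarrow> ('x list \<Rightarrow>\<^sub>0 'k::field) \<Rightarrow> 'x list \<Rightarrow>\<^sub>0 'k" where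
  "br x y u = rmul y (rmul x u) - rmul x (rmul y u)"

definition lie :: "('x list \<Rightarrow>\<^sub>0 'k::field) \<Rightarrow> ('x list \<Rightarrow>\<^sub>0 'k) \<Rightarrow> 'x list \<Rightarrow>\<^sub>0 'k" where
  "lie p q = zin_mul p q - zin_mul q p"

lemma linear_br: "pm_linear (br x y :: ('x list \<Rightarrow>\<^sub>0 'k::field) \<Rightarrow> _)"
  by (rule pm_linearI) (auto simp: br_def pm.scale_right_diff_distrib)

lemma linear_lie_left: "pm_linear (\<lambda>p. lie p q)" and linear_lie_right: "pm_linear (lie p)"
  by (rule pm_linearI; simp add: lie_def pm.scale_right_diff_distrib)+

lemmas lie_linear [simp] = pm_linearD[OF linear_br] pm_linearD[OF linear_lie_left] pm_linearD[OF linear_lie_right]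

lemma lie_anticomm: "lie p q = - lie q p"
  by (simp add: lie_def)

lemma zin_mul_br: "zin_mul p (br x y u) = rmul y (shp p (rmul x u)) - rmul x (shp p (rmul y u))"
  by (simp add: br_def zin_mul_rmul)

lemma lie_letters: "lie (letter x) (letter y) = br x y pm_one"
  by (simp add: lie_def zin_mul_letter br_def rmul_one del: rmul_single)

text \<open>For \<open>z = x\<close> the two occurrences of \<open>u y x x\<close> cancel, for
  \<open>z = y\<close> those of \<open>u x y y\<close>. The coefficient 1 of \<open>rmul z u\<close>
  is the \<open>c = 1\<close> of the later uses of absorption.\<close>

lemma lie_letter_br:
  assumes "z \<in> {x, y}"
  shows "lie (letter z) (br x y u) = br x y (shp (letter z) u + rmul z u)"
  using assms
  by (auto simp: lie_def zin_mul_rmul zin_mul_letter shp_letter_rmul br_def algebra_simps)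

lemma lie_br_br:
  "lie (br x y u) (br x y v) = br x y (shp (rmul x u) (rmul y v) - shp (rmul y u) (rmul x v) +
     shp (br x y u) v - shp (br x y v) u)"
  by (simp add: lie_def zin_mul_rmul br_def shp_rmul_rmul)
     (simp add: shp_commute algebra_simps)

section \<open>The free special Tortkara algebra on two generators\<close>

lemma minus_Zin_simps [simp]:
  "carr (minus_algebra (Zin X)) = carr (Zin X)" "scl (minus_algebra (Zin X)) = pm_scale"
  "mul (minus_algebra (Zin X)) = lie"
  by (simp_all add: minus_algebra_def lie_def fun_eq_iff)

lemma ST_simps [simp]: "scl (ST X) = pm_scale" "mul (ST X) = lie"
  by (simp_all add: ST_def generated_subalgebra_def del: Zin_simps)

lemma carr_ST: "carr (ST X) = \<Inter>{U. subalgebra U (minus_algebra (Zin X)) \<and> letter ` X \<subseteq> U}"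
  by (simp add: ST_def generated_subalgebra_def)

lemma lie_in_Zin: "p \<in> carr (Zin X) \<Longrightarrow> q \<in> carr (Zin X) \<Longrightarrow> lie p q \<in> carr (Zin X)"
  unfolding lie_def by (intro pm.subspace_diff[OF subspace_Zin] zin_mul_in_Zin)

lemma subalgebra_minus_Zin:
  "subalgebra U (minus_algebra (Zin X)) \<longleftrightarrow>
     U \<subseteq> carr (Zin X) \<and> pm.subspace U \<and> (\<forall>p\<in>U. \<forall>q\<in>U. lie p q \<in> U)"
  by (simp add: subalgebra_def)

lemma ST_subset:
  assumes "U \<subseteq> carr (Zin X)" "pm.subspace U" "\<And>p q. p \<in> U \<Longrightarrow> q \<in> U \<Longrightarrow> lie p q \<in> U"
    "letter ` X \<subseteq> U"
  shows "carr (ST X) \<subseteq> U"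
  using assms unfolding carr_ST by (intro Inter_lower) (simp add: subalgebra_minus_Zin)

lemma ST_sub_Zin: "carr (ST X) \<subseteq> carr (Zin X)"
  by (rule ST_subset[OF _ subspace_Zin]) (auto simp: lie_in_Zin letter_in_Zin)

lemma subspace_ST: "pm.subspace (carr (ST X))"
  unfolding carr_ST by (intro pm.subspace_Inter) (auto simp: subalgebra_minus_Zin)

lemma lie_ST: "p \<in> carr (ST X) \<Longrightarrow> q \<in> carr (ST X) \<Longrightarrow> lie p q \<in> carr (ST X)"
  unfolding carr_ST by (auto simp: subalgebra_minus_Zin)

lemma letter_ST: "x \<in> X \<Longrightarrow> letter x \<in> carr (ST X)"
  unfolding carr_ST by auto

definition ST2 :: "'x \<Rightarrow> 'x \<Rightarrow> ('x list \<Rightarrow>\<^sub>0 'k::field) set" where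
  "ST2 x y = {pm_scale \<alpha> (letter x) + pm_scale \<beta> (letter y) + br x y u | \<alpha> \<beta> u. u \<in> polys {x, y}}"

lemma br_ST2: "u \<in> polys {x, y} \<Longrightarrow> br x y u \<in> ST2 x y"
  unfolding ST2_def by (rule CollectI, rule exI[of _ 0], rule exI[of _ 0], rule exI[of _ u]) simp

lemma letter_ST2: "z \<in> {x, y} \<Longrightarrow> letter z \<in> ST2 x y"
proof -
  have "letter x \<in> ST2 x y" unfolding ST2_def
    by (rule CollectI, rule exI[of _ 1], rule exI[of _ 0], rule exI[of _ 0])
      (simp add: pm.subspace_0[OF subspace_polys])
  moreover have "letter y \<in> ST2 x y" unfolding ST2_def
    by (rule CollectI, rule exI[of _ 0], rule exI[of _ 1], rule exI[of _ 0])
      (simp add: pm.subspace_0[OF subspace_polys])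
  ultimately show "z \<in> {x, y} \<Longrightarrow> letter z \<in> ST2 x y" by auto
qed

lemma subspace_ST2: "pm.subspace (ST2 x y :: ('x list \<Rightarrow>\<^sub>0 'k::field) set)"
proof (rule pm.subspaceI)
  show "0 \<in> ST2 x y" using br_ST2[OF pm.subspace_0[OF subspace_polys], of x y] by simp
  fix p q :: "'x list \<Rightarrow>\<^sub>0 'k" assume "p \<in> ST2 x y" "q \<in> ST2 x y"
  then obtain \<alpha> \<beta> u \<alpha>' \<beta>' u' where
    "p = pm_scale \<alpha> (letter x) + pm_scale \<beta> (letter y) + br x y u" "u \<in> polys {x, y}"
    "q = pm_scale \<alpha>' (letter x) + pm_scale \<beta>' (letter y) + br x y u'" "u' \<in> polys {x, y}"
    unfolding ST2_def by auto
  then have "p + q = pm_scale (\<alpha> + \<alpha>') (letter x) + pm_scale (\<beta> + \<beta>') (letter y) + br x y (u + u')"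
    "u + u' \<in> polys {x, y}"
    by (auto simp: pm.scale_left_distrib pm.subspace_add[OF subspace_polys])
  then show "p + q \<in> ST2 x y" unfolding ST2_def by blast
next
  fix c and p :: "'x list \<Rightarrow>\<^sub>0 'k" assume "p \<in> ST2 x y"
  then obtain \<alpha> \<beta> u where
    "p = pm_scale \<alpha> (letter x) + pm_scale \<beta> (letter y) + br x y u" "u \<in> polys {x, y}"
    unfolding ST2_def by auto
  then have "pm_scale c p = pm_scale (c * \<alpha>) (letter x) + pm_scale (c * \<beta>) (letter y) + br x y (pm_scale c u)"
    "pm_scale c u \<in> polys {x, y}"
    by (auto simp: pm.scale_right_distrib pm.subspace_scale[OF subspace_polys])
  then show "pm_scale c p \<in> ST2 x y" unfolding ST2_def by blast
qed

lemma letter_in_polys: "z \<in> X \<Longrightarrow> letter z \<in> polys X"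
  by (simp add: polys_def letter_def)

lemmas polys_closed = pm.subspace_add[OF subspace_polys] pm.subspace_diff[OF subspace_polys]
  pm.subspace_neg[OF subspace_polys]
  pm.subspace_scale[OF subspace_polys] rmul_in_polys shp_in_polys letter_in_polys one_in_polys

lemma br_in_polys: "x \<in> X \<Longrightarrow> y \<in> X \<Longrightarrow> u \<in> polys X \<Longrightarrow> br x y u \<in> polys X"
  unfolding br_def by (intro polys_closed)

lemma br_in_Zin: "u \<in> polys {x, y} \<Longrightarrow> br x y u \<in> carr (Zin {x, y})"
  by (simp add: carr_Zin_polys br_in_polys) (simp add: br_def lookup_minus)

lemma ST2_sub_Zin: "ST2 x y \<subseteq> carr (Zin {x, y})"
  unfolding ST2_def
  by (auto intro!: pm.subspace_add[OF subspace_Zin] pm.subspace_scale[OF subspace_Zin] letter_in_Zin br_in_Zin)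

lemma lie_ST2:
  fixes p q :: "'x list \<Rightarrow>\<^sub>0 'k::field"
  assumes "p \<in> ST2 x y" "q \<in> ST2 x y"
  shows "lie p q \<in> ST2 x y"
proof -
  have letters: "lie (letter a) (letter b) \<in> (ST2 x y :: ('x list \<Rightarrow>\<^sub>0 'k) set)" if "a \<in> {x, y}" "b \<in> {x, y}" for a b
  proof -
    have "lie (letter x) (letter y) \<in> (ST2 x y :: ('x list \<Rightarrow>\<^sub>0 'k) set)" unfolding lie_letters by (intro br_ST2 one_in_polys)
    moreover from this have "lie (letter y) (letter x) \<in> (ST2 x y :: ('x list \<Rightarrow>\<^sub>0 'k) set)"
      by (subst lie_anticomm) (rule pm.subspace_neg[OF subspace_ST2])
    moreover have "lie r r = 0" for r :: "'x list \<Rightarrow>\<^sub>0 'k" by (simp add: lie_def)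
    ultimately show ?thesis using that pm.subspace_0[OF subspace_ST2] by auto
  qed
  have lb: "lie (letter z) (br x y u) \<in> ST2 x y" if "z \<in> {x, y}" "u \<in> polys {x, y}" for z u
    unfolding lie_letter_br[OF that(1)] using that by (intro br_ST2 polys_closed)
  have bl: "lie (br x y u) (letter z) \<in> ST2 x y" if "z \<in> {x, y}" "u \<in> polys {x, y}" for z u
    by (subst lie_anticomm) (intro pm.subspace_neg[OF subspace_ST2] lb that)
  have bb: "lie (br x y u) (br x y v) \<in> ST2 x y" if "v \<in> polys {x, y}" "u \<in> polys {x, y}" for u v
    unfolding lie_br_br using that by (intro br_ST2 polys_closed br_in_polys) auto
  obtain \<alpha> \<beta> u \<alpha>' \<beta>' u' where
    *: "p = pm_scale \<alpha> (letter x) + pm_scale \<beta> (letter y) + br x y u" "u \<in> polys {x, y}"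
      "q = pm_scale \<alpha>' (letter x) + pm_scale \<beta>' (letter y) + br x y u'" "u' \<in> polys {x, y}"
    using assms unfolding ST2_def by auto
  show ?thesis
    unfolding *(1,3) lie_linear pm.scale_right_distrib using *(2,4)
    by (intro pm.subspace_add[OF subspace_ST2] pm.subspace_scale[OF subspace_ST2] letters lb bl bb) auto
qed

lemma carr_ST2: "carr (ST {x, y}) = (ST2 x y :: ('x list \<Rightarrow>\<^sub>0 'k::field_char_0) set)"
proof
  show "carr (ST {x, y}) \<subseteq> (ST2 x y :: ('x list \<Rightarrow>\<^sub>0 'k) set)"
    by (rule ST_subset[OF ST2_sub_Zin subspace_ST2 lie_ST2]) (auto intro: letter_ST2)
next
  interpret C: right_filtration x y "constants :: ('x list \<Rightarrow>\<^sub>0 'k) set" 1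
    by (rule right_filtration_constants)
  define M where "M = {u :: 'x list \<Rightarrow>\<^sub>0 'k. br x y u \<in> carr (ST {x, y})}"
  have "C.J \<subseteq> M"
  \<comment> \<open>Bracketing with letters only gives \<open>(z \<squnion> j + j z)[x, y]\<close>;
    absorption starting from the constants reaches \<open>u[x, y]\<close> for every polynomial
    \<open>u\<close>.\<close>
  proof (rule C.absorb_J[of _ 1])
    show "pm.subspace M" unfolding M_def
      by (rule pm.subspaceI)
        (auto simp: pm.subspace_0[OF subspace_ST] pm.subspace_add[OF subspace_ST] pm.subspace_scale[OF subspace_ST])
    show "constants \<subseteq> M"
      using lie_ST[of "letter x" "{x, y}" "letter y"]
      by (auto simp: constants_def M_def letter_ST lie_letters simp del: pm_scale_single
          intro!: pm.subspace_scale[OF subspace_ST])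
    fix z j assume "z \<in> {x, y}" "j \<in> M"
    then show "shp (letter z) j + pm_scale (of_nat 1) (rmul z j) \<in> M"
      using lie_ST[of "letter z" "{x, y}" "br x y j"] by (auto simp: M_def lie_letter_br letter_ST)
  qed simp
  then have "br x y u \<in> carr (ST {x, y})" if "u \<in> polys {x, y}" for u :: "'x list \<Rightarrow>\<^sub>0 'k"
    using that unfolding J_constants M_def by blast
  then show "(ST2 x y :: ('x list \<Rightarrow>\<^sub>0 'k) set) \<subseteq> carr (ST {x, y})"
    unfolding ST2_def
    by (auto intro!: pm.subspace_add[OF subspace_ST] pm.subspace_scale[OF subspace_ST] letter_ST)
qed

lemma lie_eq_shp:
  assumes "p \<in> carr (Zin X)" "q \<in> carr (Zin X)"
  shows "lie p q = shp p q - pm_scale 2 (zin_mul q p)"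
proof -
  have "pm_scale 2 (zin_mul q p) = zin_mul q p + zin_mul q p"
    by (rule poly_mapping_eqI) (simp add: lookup_add)
  then show ?thesis using zin_mul_symm[OF assms] by (simp add: lie_def algebra_simps)
qed

lemma lie_letter:
  assumes "z \<in> X" "q \<in> carr (Zin X)"
  shows "lie (letter z) q = shp (letter z) q - pm_scale 2 (rmul z q)"
  using lie_eq_shp[OF letter_in_Zin[OF assms(1)] assms(2)] by (simp add: zin_mul_letter)

lemma rmul_in_Zin: "z \<in> X \<Longrightarrow> p \<in> polys X \<Longrightarrow> rmul z p \<in> carr (Zin X)"
  by (simp add: carr_Zin_polys rmul_in_polys)

lemma shp_br_rmul:
  "shp (br x y u) (rmul a v) =
     rmul y (shp (rmul x u) (rmul a v)) - rmul x (shp (rmul y u) (rmul a v)) + rmul a (shp (br x y u) v)"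
  by (simp add: br_def shp_rmul_rmul)

lemma br_swap: "br y x u = - br x y u"
  by (simp add: br_def)

lemma ST2_swap: "ST2 y x = (ST2 x y :: ('x list \<Rightarrow>\<^sub>0 'k::field_char_0) set)"
  unfolding carr_ST2[symmetric] by (simp add: insert_commute)

lemma rder_letter [simp]: "rder a (letter b) = (if a = b then pm_one else 0)"
  using rder_single_snoc(1)[of a "[]" b 1] by (simp add: letter_def)

section \<open>Ideals in two generators\<close>

text \<open>\<open>I\<close> stands for the kernel of a homomorphism. Stability under brackets from
  one side suffices by anticommutativity.\<close>

locale two_generator_ideal =
  fixes x y :: 'x and I :: "('x list \<Rightarrow>\<^sub>0 'k::field_char_0) set"
  assumes x_neq_y: "x \<noteq> y" and subspace_ideal: "pm.subspace I" and ideal_sub: "I \<subseteq> ST2 x y"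
    and lie_ideal: "\<And>p i. p \<in> ST2 x y \<Longrightarrow> i \<in> I \<Longrightarrow> lie p i \<in> I"
begin

lemma I_Zin: "i \<in> I \<Longrightarrow> i \<in> carr (Zin {x, y})"
  by (rule subsetD[OF ST2_sub_Zin subsetD[OF ideal_sub]])

sublocale right_filtration x y I 2
proof
  fix z i assume zi: "z \<in> {x, y}" "i \<in> I"
  then have "lie (letter z) i \<in> I" by (intro lie_ideal letter_ST2)
  then show "shp (letter z) i - pm_scale (of_nat 2) (rmul z i) \<in> I"
    using lie_letter[OF zi(1) I_Zin[OF zi(2)]] by simp
next
  show "pm.subspace I" by (rule subspace_ideal)
qed simp

text \<open>The symmetry allows \<open>rmul_y_cancel\<close> to be used for the letter
  \<open>x\<close> as well.\<close>

lemma swap: "two_generator_ideal y x I"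
  by unfold_locales (use x_neq_y subspace_ideal ideal_sub lie_ideal in \<open>auto simp: ST2_swap[of y x]\<close>)

lemma J_swap: "right_filtration.J y x I = J"
proof
  interpret S: two_generator_ideal y x I by (rule swap)
  show "S.J \<subseteq> J" by (rule S.J_subset[OF subspace_J]) (auto intro: I_J J_rmul)
  show "J \<subseteq> S.J" by (rule J_subset[OF S.subspace_J]) (auto intro: S.I_J S.J_rmul)
qed

lemma J_Zin: "j \<in> J \<Longrightarrow> j \<in> carr (Zin {x, y})"
proof -
  have "J \<subseteq> carr (Zin {x, y})"
    by (rule J_subset[OF subspace_Zin]) (use carr_Zin_polys in \<open>auto intro: I_Zin rmul_in_Zin\<close>)
  then show "j \<in> J \<Longrightarrow> j \<in> carr (Zin {x, y})" by blast
qed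

lemmas J_closed = pm.subspace_add[OF subspace_J] pm.subspace_diff[OF subspace_J]
  pm.subspace_neg[OF subspace_J] pm.subspace_scale[OF subspace_J]

section \<open>Stability of \<open>J\<close> under shuffles and Zinbiel products\<close>

definition multipliers where
  "multipliers = {p \<in> polys {x, y}. \<forall>j\<in>J. shp p j \<in> J}"

lemma subspace_multipliers: "pm.subspace multipliers"
  unfolding multipliers_def
  by (rule pm.subspaceI)
    (auto simp: pm.subspace_0[OF subspace_polys] pm.subspace_0[OF subspace_J] intro: polys_closed J_closed)

lemma letter_multipliers: "z \<in> {x, y} \<Longrightarrow> p \<in> multipliers \<Longrightarrow> shp (letter z) p \<in> multipliers"
  unfolding multipliers_def by (auto simp: shp_assoc intro!: polys_closed intro: J_letter)

text \<open>On \<open>I\<close>, the shuffle with \<open>w = u[x, y]\<close> is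
  \<open>[w, i] + 2 i \<circ> w\<close>, where the bracket lies in \<open>I\<close> and
  \<open>i \<circ> w = (i \<squnion> u x) y - (i \<squnion> u y) x\<close>. On products
  \<open>v a\<close> the shuffle is reduced by its last letter, which again leaves only shuffles
  with \<open>u x\<close> and \<open>u y\<close>, or a smaller instance.\<close>

lemma br_multipliers:
  assumes "u \<in> polys {x, y}" "rmul x u \<in> multipliers" "rmul y u \<in> multipliers"
  shows "br x y u \<in> multipliers"
proof -
  have sub: "pm.subspace {j. shp (br x y u) j \<in> J}"
    by (rule pm.subspaceI) (auto simp: pm.subspace_0[OF subspace_J] intro: J_closed)
  have m: "shp (rmul x u) j \<in> J" "shp (rmul y u) j \<in> J" if "j \<in> J" for j
    using assms that unfolding multipliers_def by auto
  have "J \<subseteq> {j. shp (br x y u) j \<in> J}"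
  proof (rule J_subset[OF sub])
    show "I \<subseteq> {j. shp (br x y u) j \<in> J}"
    proof (intro subsetI CollectI)
      fix i assume i: "i \<in> I"
      have "shp (br x y u) i = lie (br x y u) i + pm_scale 2 (zin_mul i (br x y u))"
        by (simp add: lie_eq_shp[OF br_in_Zin[OF assms(1)] I_Zin[OF i]])
      also have "\<dots> \<in> J"
        unfolding zin_mul_br shp_commute[of i]
        by (intro J_closed J_rmul m I_J lie_ideal br_ST2 assms i) auto
      finally show "shp (br x y u) i \<in> J" .
    qed
    fix z j assume "z \<in> {x, y}" "j \<in> J" "j \<in> {j. shp (br x y u) j \<in> J}"
    then show "rmul z j \<in> {j. shp (br x y u) j \<in> J}"
      unfolding mem_Collect_eq shp_br_rmul by (intro J_closed J_rmul m) auto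
  qed
  moreover have "br x y u \<in> polys {x, y}" using assms(1) by (intro br_in_polys) auto
  ultimately show ?thesis unfolding multipliers_def by blast
qed

text \<open>
  By induction on degree: a word \<open>j z a\<close> is a multiplier once \<open>(z \<squnion> j + j z) a\<close> is, by absorption, and the
  latter differs from \<open>z \<squnion> j a\<close> by \<open>j [z, a]\<close>, to which \<open>br_multipliers\<close> applies.
\<close>

lemma J_shp:
  assumes "p \<in> polys {x, y}" "j \<in> J"
  shows "shp p j \<in> J"
proof -
  interpret C: right_filtration x y "constants :: ('x list \<Rightarrow>\<^sub>0 'k) set" 1
    by (rule right_filtration_constants)
  have Cpolys: "u \<in> polys {x, y}" if "u \<in> C.rid n" for u n
    using C.rid_J[OF that] unfolding J_constants .
  have const: "constants \<subseteq> multipliers"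
    by (auto simp: constants_def multipliers_def simp del: pm_scale_single intro!: polys_closed J_closed)
  have "C.rid n \<subseteq> multipliers" for n
  proof (induction n)
    case 0
    then show ?case using const by simp
  next
    case (Suc n)
    show ?case
    proof (rule C.rid_Suc_subset[OF subspace_multipliers const])
      fix a u assume a: "a \<in> {x, y}" and u: "u \<in> C.rid n"
      define M where "M = {u. rmul a u \<in> multipliers}"
      have M: "pm.subspace M" unfolding M_def
        by (rule pm.subspaceI)
          (auto simp: pm.subspace_0[OF subspace_multipliers] pm.subspace_add[OF subspace_multipliers]
            pm.subspace_scale[OF subspace_multipliers])
      have "letter a \<in> multipliers" 
        using letter_multipliers[OF a, of pm_one] const by (auto simp: constants_def intro!: image_eqI[of _ _ 1])
      then have CM: "constants \<subseteq> M"
        by (auto simp: constants_def M_def rmul_one simp del: pm_scale_single rmul_single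
            intro!: pm.subspace_scale[OF subspace_multipliers])
      have "C.rid n \<subseteq> M"
      proof (cases n)
        case (Suc m)
        show ?thesis unfolding Suc
        \<comment> \<open>Here \<open>j\<close> has level \<open>m\<close>, so \<open>j x\<close>
          and \<open>j y\<close> have level \<open>n = Suc m\<close> and are multipliers by the
          induction hypothesis, although the words \<open>j z a\<close> are one level too high for
          it.\<close>
        proof (rule C.absorb[OF M CM, of 1])
          fix z j assume z: "z \<in> {x, y}" and j: "j \<in> C.rid m"
          have mult: "rmul b j \<in> multipliers" if "b \<in> {x, y}" for b
            using C.rid_rmul[OF j that] Suc.IH Suc by auto
          have "br x y j \<in> multipliers" by (intro br_multipliers mult Cpolys[OF j]) auto
          then have br: "rmul a (rmul z j) - rmul z (rmul a j) \<in> multipliers"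
            using a z pm.subspace_neg[OF subspace_multipliers, of "br x y j"]
              pm.subspace_0[OF subspace_multipliers] by (auto simp: br_def)
          have "rmul a (shp (letter z) j + pm_scale (of_nat 1) (rmul z j)) =
              shp (letter z) (rmul a j) + (rmul a (rmul z j) - rmul z (rmul a j))"
            by (simp add: shp_letter_rmul)
          also have "\<dots> \<in> multipliers"
            by (intro pm.subspace_add[OF subspace_multipliers] letter_multipliers z mult a br)
          finally show "shp (letter z) j + pm_scale (of_nat 1) (rmul z j) \<in> M"
            unfolding M_def by simp
        qed simp
      qed (use CM in simp)
      then show "rmul a u \<in> multipliers" using u unfolding M_def by auto
    qed
  qed
  then have "C.J \<subseteq> multipliers" unfolding C.J_def by blast
  then show ?thesis using assms unfolding J_constants multipliers_def by blast
qed

lemma J_zin_mul_right: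
  assumes "j \<in> J" "p \<in> carr (Zin {x, y})"
  shows "zin_mul j p \<in> J"
proof -
  have p: "p \<in> polys {x, y}" "Poly_Mapping.lookup p [] = 0" using assms(2) by (auto simp: carr_Zin_polys)
  have "zin_mul j p = zin_mul j (rmul x (rder x p) + rmul y (rder y p))"
    using polys_expand[OF p(1) x_neq_y] p(2) by simp
  also have "\<dots> = rmul x (shp (rder x p) j) + rmul y (shp (rder y p) j)"
    by (simp add: zin_mul_rmul shp_commute)
  also have "\<dots> \<in> J" by (intro J_closed J_rmul J_shp rder_in_polys p assms) auto
  finally show ?thesis .
qed

lemma J_zin_mul_left:
  assumes "p \<in> polys {x, y}" "j \<in> J"
  shows "zin_mul p j \<in> J"
  using assms(1)
proof (induction p rule: polys_induct)
  case one
  have "j \<in> polys {x, y}" "Poly_Mapping.lookup j [] = 0" using J_Zin[OF assms(2)] by (auto simp: carr_Zin_polys)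
  then have eq: "rmul x (rder x j) + rmul y (rder y j) = j" using polys_expand[of j x y] x_neq_y by simp
  have "zin_mul pm_one (rmul x (rder x j) + rmul y (rder y j)) = rmul x (rder x j) + rmul y (rder y j)"
    by (simp add: zin_mul_rmul)
  then show ?case using assms(2) unfolding eq by simp
next
  case (rmul z p)
  then have Z: "rmul z p \<in> carr (Zin {x, y})" by (intro rmul_in_Zin)
  have "zin_mul (rmul z p) j = shp (rmul z p) j - zin_mul j (rmul z p)"
    using zin_mul_symm[OF Z J_Zin[OF assms(2)]] by (simp add: algebra_simps)
  also have "\<dots> \<in> J" using rmul by (intro J_closed J_shp polys_closed assms(2) J_zin_mul_right Z)
  finally show ?case .
qed (auto intro: J_closed)

section \<open>The intersection of \<open>J\<close> with the free special Tortkara algebra\<close>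

lemma br_I:
  assumes "i \<in> I"
  shows "br x y i \<in> I"
proof -
  have l: "lie (letter z) j = shp (letter z) j - pm_scale 2 (rmul z j)" "lie (letter z) j \<in> I"
    if "z \<in> {x, y}" "j \<in> I" for z j
    by (rule lie_letter[OF that(1) I_Zin[OF that(2)]], rule lie_ideal[OF letter_ST2[OF that(1)] that(2)])
  have "lie (letter x) (lie (letter y) i) - lie (letter y) (lie (letter x) i) \<in> I"
    using assms by (intro pm.subspace_diff[OF subspace_I] l(2)) auto
  \<comment> \<open>The terms containing shuffles are symmetric in \<open>x\<close> and
    \<open>y\<close> and cancel; \<open>2 i y x - 2 i x y\<close> remains.\<close>
  moreover have "lie (letter x) (lie (letter y) i) - lie (letter y) (lie (letter x) i) = pm_scale (-2) (br x y i)"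
    unfolding l(1)[OF insertI1 l(2)[OF insertI2[OF singletonI] assms]]
      l(1)[OF insertI2[OF singletonI] l(2)[OF insertI1 assms]]
    unfolding
      l(1)[OF insertI1 assms] l(1)[OF insertI2[OF singletonI] assms]
    by (rule poly_mapping_eqI)
      (simp add: lookup_add lookup_minus br_def shp_letter_rmul shp_left_commute[of "letter x"] algebra_simps)
  ultimately have "pm_scale (-2) (br x y i) \<in> I" by metis
  then show ?thesis by (rule subspace_scaleD[OF subspace_I]) simp
qed

text \<open>If \<open>j[x, y]\<close> is in \<open>I\<close>, so is
  \<open>[z, j[x, y]] = (z \<squnion> j + j z)[x, y]\<close>, which is the closure condition of
  absorption with \<open>c = 1\<close>.\<close>

lemma br_J: "j \<in> J \<Longrightarrow> br x y j \<in> I"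
proof -
  have "J \<subseteq> {j. br x y j \<in> I}"
  proof (rule absorb_J[of _ 1])
    show "pm.subspace {j. br x y j \<in> I}"
      by (rule pm.subspaceI)
        (auto simp: pm.subspace_0[OF subspace_I] pm.subspace_add[OF subspace_I] pm.subspace_scale[OF subspace_I])
    fix z j assume "z \<in> {x, y}" "j \<in> {j. br x y j \<in> I}"
    then show "shp (letter z) j + pm_scale (of_nat 1) (rmul z j) \<in> {j. br x y j \<in> I}"
      using lie_ideal[OF letter_ST2[of z x y], of "br x y j"] by (auto simp: lie_letter_br)
  qed (auto intro: br_I)
  then show "j \<in> J \<Longrightarrow> br x y j \<in> I" by blast
qed

lemma rder_br: "rder x (br x y u) = - rmul y u" "rder y (br x y u) = rmul x u"
  using x_neq_y by (auto simp: br_def)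

lemma rder_ST2_form:
  "rder x (pm_scale \<alpha> (letter x) + pm_scale \<beta> (letter y) + br x y u) = pm_scale \<alpha> pm_one - rmul y u"
  "rder y (pm_scale \<alpha> (letter x) + pm_scale \<beta> (letter y) + br x y u) = pm_scale \<beta> pm_one + rmul x u"
  using x_neq_y by (simp_all add: rder_br)

text \<open>Write \<open>v y = i + a x + b y\<close> with \<open>a\<close>, \<open>b\<close> one
  level lower, and let \<open>u[x, y]\<close> be the bracket part of \<open>i\<close>. Words ending
  in \<open>x\<close> give \<open>u y = a\<close>, so \<open>u\<close> is in \<open>J\<close> by
  induction; words ending in \<open>y\<close> give \<open>v = \<beta> + u x + b\<close>, and
  \<open>no\<close> removes the constant \<open>\<beta>\<close>.\<close>

lemma rmul_y_cancel:
  assumes no: "\<And>\<beta> u. u \<in> polys {x, y} \<Longrightarrow> pm_scale \<beta> (letter y) + br x y u \<in> I \<Longrightarrow> \<beta> = 0"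
    and v: "rmul y v \<in> J"
  shows "v \<in> J"
proof -
  have "rmul y v \<in> rid n \<Longrightarrow> v \<in> J" for n
    using v
  proof (induction n arbitrary: v)
    case 0
    then have "rmul y v \<in> ST2 x y" using ideal_sub by auto
    then obtain \<alpha> \<beta> u where u: "u \<in> polys {x, y}"
      and eq: "rmul y v = pm_scale \<alpha> (letter x) + pm_scale \<beta> (letter y) + br x y u"
      unfolding ST2_def by blast
    have ux: "0 = pm_scale \<alpha> pm_one - rmul y u" and uy: "v = pm_scale \<beta> pm_one + rmul x u"
      using arg_cong[OF eq, of "rder x"] arg_cong[OF eq, of "rder y"] x_neq_y
      unfolding rder_ST2_form by simp_all
    have \<alpha>: "\<alpha> = 0" using arg_cong[OF ux, of "\<lambda>p. Poly_Mapping.lookup p []"] by (simp add: lookup_minus lookup_single)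
    have "u = 0" using arg_cong[OF ux, of "rder y"] \<alpha> by simp
    then have "\<beta> = 0" using no[of 0 \<beta>] 0 eq \<alpha> u by simp
    then show ?case using uy \<open>u = 0\<close> pm.subspace_0[OF subspace_J] by simp
  next
    case (Suc n)
    then obtain i a b where *: "rmul y v = i + rmul x a + rmul y b" "i \<in> I" "a \<in> rid n" "b \<in> rid n"
      by (auto simp: rid.simps(2))
    obtain \<alpha> \<beta> u where u: "u \<in> polys {x, y}"
      and i: "i = pm_scale \<alpha> (letter x) + pm_scale \<beta> (letter y) + br x y u"
      using *(2) ideal_sub unfolding ST2_def by blast
    have ri: "rder x i = pm_scale \<alpha> pm_one - rmul y u" "rder y i = pm_scale \<beta> pm_one + rmul x u"
      unfolding i rder_ST2_form by (rule refl)+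
    have ux: "0 = pm_scale \<alpha> pm_one - rmul y u + a"
      using arg_cong[OF *(1), of "rder x"] x_neq_y by (simp add: ri)
    have uy: "v = pm_scale \<beta> pm_one + rmul x u + b"
      using arg_cong[OF *(1), of "rder y"] x_neq_y by (simp add: ri)
    have "Poly_Mapping.lookup a [] = 0" using J_Zin[OF rid_J[OF *(3)]] by (simp add: carr_Zin_polys)
    then have \<alpha>: "\<alpha> = 0"
      using arg_cong[OF ux, of "\<lambda>p. Poly_Mapping.lookup p []"] by (simp add: lookup_minus lookup_add lookup_single)
    have "rmul y u = a" using ux \<alpha> by simp
    then have uJ: "u \<in> J" using Suc.IH[of u] *(3) rid_J by blast
    have "\<beta> = 0" using no[OF u, of \<beta>] *(2) i \<alpha> by simp
    then show ?case using uy uJ *(4) by (simp add: J_closed J_rmul rid_J)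
  qed
  then show ?thesis using v unfolding J_def by blast
qed

text \<open>
  Modulo \<open>J\<close> the assumptions say \<open>A x + B y = 0\<close> and \<open>C x + D y = 0\<close>, where \<open>A\<close>, \<open>B\<close>, \<open>C\<close>, \<open>D\<close> act by left
  multiplication, and \<open>e = 1 - d\<close> is the determinant of this system. Then \<open>d\<close> is a left unit, and
  \<open>d \<circ> (d \<circ> z) = 2 ((d \<circ> d) \<circ> z)\<close> forces \<open>z = 2 z\<close>.
\<close>

lemma perfect_case:
  assumes u: "u \<in> polys {x, y}" "letter x + br x y u \<in> I"
    and v: "v \<in> polys {x, y}" "letter y + br x y v \<in> I"
  shows "ST2 x y \<subseteq> I"
proof -
  define A B C D where "A = pm_one - rmul y u" and "B = rmul x u"
    and "C = - rmul y v" and "D = pm_one + rmul x v"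
  note defs = A_def B_def C_def D_def
  have polys: "A \<in> polys {x, y}" "B \<in> polys {x, y}" "C \<in> polys {x, y}" "D \<in> polys {x, y}"
    unfolding defs using u v by (auto intro!: polys_closed)
  have "rmul x A + rmul y B = letter x + br x y u" "rmul x C + rmul y D = letter y + br x y v"
    unfolding defs br_def by (simp_all add: rmul_one del: rmul_single)
  then have AB: "rmul x A + rmul y B \<in> J" and CD: "rmul x C + rmul y D \<in> J"
    using u(2) v(2) I_J by metis+
  define e where "e = shp A D - shp B C"
  define d where "d = pm_one - e"
  \<comment> \<open>Cramer's rule; it is available because the coefficients multiply by the
    commutative shuffle product.\<close>
  have xe: "rmul x e = zin_mul D (rmul x A + rmul y B) - zin_mul B (rmul x C + rmul y D)"
    by (simp add: e_def zin_mul_rmul shp_commute)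
  have ye: "rmul y e = zin_mul A (rmul x C + rmul y D) - zin_mul C (rmul x A + rmul y B)"
    by (simp add: e_def zin_mul_rmul shp_commute)
  have "rmul x e \<in> J" "rmul y e \<in> J"
    unfolding xe ye by (intro J_closed(2) J_zin_mul_left polys AB CD)+
  then have e: "rmul z e \<in> J" if "z \<in> {x, y}" for z
    using that by auto
  have d_polys: "d \<in> polys {x, y}" unfolding d_def e_def by (intro polys_closed polys)
  have d0: "Poly_Mapping.lookup d [] = 0"
    unfolding d_def e_def defs by (simp add: lookup_minus lookup_add lookup_single)
  have d_Zin: "d \<in> carr (Zin {x, y})" using d_polys d0 by (simp add: carr_Zin_polys)
  have d_unit: "rmul z q - rmul z (shp q d) \<in> J" if "z \<in> {x, y}" "q \<in> polys {x, y}" for z q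
    using J_zin_mul_left[OF that(2) e[OF that(1)]] by (simp add: zin_mul_rmul d_def)
  have d_eq: "d = rmul x (rder x d) + rmul y (rder y d)"
    using polys_expand[OF d_polys x_neq_y] d0 by simp
  have dd: "d - zin_mul d d \<in> J"
  proof -
    have "d - zin_mul d d = (rmul x (rder x d) + rmul y (rder y d)) -
        zin_mul d (rmul x (rder x d) + rmul y (rder y d))"
      using d_eq by metis
    also have "\<dots> = (rmul x (rder x d) - rmul x (shp (rder x d) d)) + (rmul y (rder y d) - rmul y (shp (rder y d) d))"
      by (simp add: zin_mul_rmul shp_commute)
    also have "\<dots> \<in> J" by (intro J_closed d_unit rder_in_polys d_polys) auto
    finally show ?thesis .
  qed
  have letterJ: "letter z \<in> J" if z: "z \<in> {x, y}" for z
  proof -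
    have dd2: "shp d d = zin_mul d d + zin_mul d d" using zin_mul_symm[OF d_Zin d_Zin] by simp
    have ed: "rmul z e = letter z - rmul z d" by (simp add: d_def rmul_one del: rmul_single)
    \<comment> \<open>Modulo \<open>J\<close> one has
      \<open>d z = (d \<squnion> d) z = 2 (d \<circ> d) z = 2 d z\<close>, so \<open>d z\<close>
      vanishes, and \<open>z = d z + e z\<close> does too.\<close>
    have "letter z = rmul z e - (rmul z d - rmul z (shp d d)) + pm_scale 2 (rmul z (d - zin_mul d d))"
      unfolding ed dd2 by (rule poly_mapping_eqI) (simp add: lookup_minus lookup_add algebra_simps)
    also have "\<dots> \<in> J" by (intro J_closed J_rmul e d_unit z d_polys dd)
    finally show ?thesis .
  qed
  have brZ: "br x y p \<in> I" if "p \<in> carr (Zin {x, y})" for p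
  proof -
    have p: "p \<in> polys {x, y}" "Poly_Mapping.lookup p [] = 0" using that by (auto simp: carr_Zin_polys)
    have "rmul x (rder x p) + rmul y (rder y p) \<in> J"
      unfolding zin_mul_letter[symmetric]
      by (intro J_closed J_zin_mul_left letterJ rder_in_polys p) auto
    then have "p \<in> J" using polys_expand[OF p(1) x_neq_y] p(2) by simp
    then show ?thesis by (rule br_J)
  qed
  \<comment> \<open>Modulo \<open>I\<close> the element \<open>p[x, y]\<close> depends only on the
    constant term of \<open>p\<close>, so both generators become multiples of
    \<open>[x, y]\<close>.\<close>
  have br_const: "br x y p - pm_scale (Poly_Mapping.lookup p []) (br x y pm_one) \<in> I" if p: "p \<in> polys {x, y}" for p
  proof -
    have "p - pm_scale (Poly_Mapping.lookup p []) pm_one \<in> carr (Zin {x, y})"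
      unfolding carr_Zin_polys using p
      by (auto simp: lookup_minus lookup_single simp del: pm_scale_single intro!: polys_closed)
    from brZ[OF this] show ?thesis by (simp del: pm_scale_single)
  qed
  define a b where ab: "a = Poly_Mapping.lookup u []" "b = Poly_Mapping.lookup v []"
  let ?r = "br x y (pm_one :: 'x list \<Rightarrow>\<^sub>0 'k)"
  have Ix: "letter x + pm_scale a ?r \<in> I" and Iy: "letter y + pm_scale b ?r \<in> I"
    using pm.subspace_diff[OF subspace_I u(2) br_const[OF u(1)]]
      pm.subspace_diff[OF subspace_I v(2) br_const[OF v(1)]] unfolding ab by (simp_all add: algebra_simps)
  have lr: "lie (letter z) ?r \<in> I" if "z \<in> {x, y}" for z
    unfolding lie_letter_br[OF that] using that
    by (intro brZ) (auto simp: rmul_one simp del: rmul_single intro!: pm.subspace_add[OF subspace_Zin] letter_in_Zin)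
  have rr: "lie ?r ?r = 0" by (simp add: lie_def)
  \<comment> \<open>Two multiples of \<open>[x, y]\<close> commute, which forces
    \<open>[x, y]\<close> itself into \<open>I\<close>, up to brackets of letters with
    \<open>?r\<close> that are already there.\<close>
  have "lie (letter x + pm_scale a ?r) (letter y + pm_scale b ?r) \<in> I"
    using Ix Iy ideal_sub by (intro lie_ideal) auto
  moreover have "lie (letter x + pm_scale a ?r) (letter y + pm_scale b ?r) =
      ?r + pm_scale b (lie (letter x) ?r) - pm_scale a (lie (letter y) ?r)"
    unfolding lie_linear rr lie_letters lie_anticomm[of ?r "letter y"]
    by (simp add: pm.scale_right_distrib)
  ultimately have "?r + pm_scale b (lie (letter x) ?r) - pm_scale a (lie (letter y) ?r) \<in> I" by metis
  moreover have "pm_scale b (lie (letter x) ?r) - pm_scale a (lie (letter y) ?r) \<in> I"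
    by (intro pm.subspace_diff[OF subspace_I] pm.subspace_scale[OF subspace_I] lr) auto
  ultimately have r: "?r \<in> I"
    using pm.subspace_diff[OF subspace_I] by (metis add_diff_cancel_right' add_diff_eq)
  have brI: "br x y p \<in> I" if "p \<in> polys {x, y}" for p
    using pm.subspace_add[OF subspace_I br_const[OF that] pm.subspace_scale[OF subspace_I r, of "Poly_Mapping.lookup p []"]] by simp
  have "letter x \<in> I" "letter y \<in> I"
    using pm.subspace_diff[OF subspace_I u(2) brI[OF u(1)]] pm.subspace_diff[OF subspace_I v(2) brI[OF v(1)]]
    by simp_all
  then show ?thesis unfolding ST2_def
    by (auto intro!: pm.subspace_add[OF subspace_I] pm.subspace_scale[OF subspace_I] brI)
qed

lemma J_inter_ST2:
  assumes "p \<in> J" "p \<in> ST2 x y"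
  shows "p \<in> I"
proof -
  interpret S: two_generator_ideal y x I by (rule swap)
  obtain i a b where *: "p = i + rmul x a + rmul y b" "i \<in> I" "a \<in> J" "b \<in> J"
    by (rule J_cases[OF assms(1)])
  have "p - i \<in> ST2 x y" using assms(2) *(2) ideal_sub by (intro pm.subspace_diff[OF subspace_ST2]) auto
  then obtain \<alpha> \<beta> u where u: "u \<in> polys {x, y}"
    and eq: "rmul x a + rmul y b = pm_scale \<alpha> (letter x) + pm_scale \<beta> (letter y) + br x y u"
    unfolding ST2_def *(1) by auto
  have ux: "a = pm_scale \<alpha> pm_one - rmul y u"
    using arg_cong[OF eq, of "rder x"] x_neq_y unfolding rder_ST2_form by simp
  have uy: "b = pm_scale \<beta> pm_one + rmul x u"
    using arg_cong[OF eq, of "rder y"] x_neq_y unfolding rder_ST2_form by simp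
  have "Poly_Mapping.lookup a [] = 0" "Poly_Mapping.lookup b [] = 0"
    using J_Zin *(3,4) by (auto simp: carr_Zin_polys)
  then have ab0: "\<alpha> = 0" "\<beta> = 0"
    using arg_cong[OF ux, of "\<lambda>p. Poly_Mapping.lookup p []"] arg_cong[OF uy, of "\<lambda>p. Poly_Mapping.lookup p []"]
    by (simp_all add: lookup_minus lookup_add lookup_single)
  have uJ: "rmul y u \<in> J" "rmul x u \<in> J"
    using J_closed(3)[OF *(3)] *(4) ux uy ab0 by auto
  have p: "p = i + br x y u" using *(1) eq ab0 by (simp add: add.assoc)
  consider "u \<in> J" | "ST2 x y \<subseteq> I"
  proof (cases "\<forall>\<beta> u. u \<in> polys {x, y} \<longrightarrow> pm_scale \<beta> (letter y) + br x y u \<in> I \<longrightarrow> \<beta> = 0")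
    case True
    then show ?thesis using rmul_y_cancel[OF _ uJ(1)] that by blast
  next
    case False
    then obtain \<beta> v where v: "\<beta> \<noteq> 0" "v \<in> polys {x, y}" "pm_scale \<beta> (letter y) + br x y v \<in> I" by blast
    show ?thesis
    proof (cases "\<forall>\<beta> u. u \<in> polys {x, y} \<longrightarrow> pm_scale \<beta> (letter x) + br y x u \<in> I \<longrightarrow> \<beta> = 0")
      case True
      then show ?thesis using S.rmul_y_cancel[of u] uJ(2) that unfolding J_swap
        by (auto simp: insert_commute)
    next
      case False
      then obtain \<alpha> w where w: "\<alpha> \<noteq> 0" "w \<in> polys {x, y}" "pm_scale \<alpha> (letter x) + br y x w \<in> I" by blast
      have "pm_scale (inverse \<beta>) (pm_scale \<beta> (letter y) + br x y v) =
          letter y + br x y (pm_scale (inverse \<beta>) v)"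
        using v(1) by (simp add: pm.scale_right_distrib)
      with pm.subspace_scale[OF subspace_I v(3)] have y: "letter y + br x y (pm_scale (inverse \<beta>) v) \<in> I"
        by metis
      \<comment> \<open>The element comes from the exchanged roles; the sign is that of
        \<open>br_swap\<close>.\<close>
      have "pm_scale (inverse \<alpha>) (pm_scale \<alpha> (letter x) + br y x w) =
          letter x + br x y (pm_scale (- inverse \<alpha>) w)"
        using w(1) by (simp add: pm.scale_right_distrib pm.scale_right_diff_distrib br_swap[of y x])
      with pm.subspace_scale[OF subspace_I w(3)] have x: "letter x + br x y (pm_scale (- inverse \<alpha>) w) \<in> I"
        by metis
      show ?thesis using perfect_case[OF _ x _ y] v(2) w(2) that polys_closed(4) by blast
    qed
  qed
  then show ?thesis
  proof cases
    case 1
    then show ?thesis unfolding p using *(2) by (intro pm.subspace_add[OF subspace_I] br_J)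
  next
    case 2
    then show ?thesis using assms(2) by blast
  qed
qed

end

section \<open>Images of the free special Tortkara algebra\<close>

locale zinbiel_algebra =
  fixes A :: "('k::field, 'v::ab_group_add) alg"
  assumes zinbiel_A: "zinbiel A"
begin

sublocale vector_space "scl A"
  using zinbiel_A by (simp add: zinbiel_def is_algebra_def)

lemma subspace_carr: "subspace (carr A)"
  using zinbiel_A by (simp add: zinbiel_def is_algebra_def)

lemma closed [simp]:
  "0 \<in> carr A"
  "a \<in> carr A \<Longrightarrow> b \<in> carr A \<Longrightarrow> a + b \<in> carr A"
  "a \<in> carr A \<Longrightarrow> b \<in> carr A \<Longrightarrow> a - b \<in> carr A"
  "a \<in> carr A \<Longrightarrow> - a \<in> carr A"
  "a \<in> carr A \<Longrightarrow> b \<in> carr A \<Longrightarrow> mul A a b \<in> carr A"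
proof -
  show "a \<in> carr A \<Longrightarrow> b \<in> carr A \<Longrightarrow> mul A a b \<in> carr A"
    using zinbiel_A unfolding zinbiel_def is_algebra_def by auto
qed (simp_all add: subspace_0[OF subspace_carr] subspace_add[OF subspace_carr]
    subspace_diff[OF subspace_carr] subspace_neg[OF subspace_carr])

lemma mul_add:
  "a \<in> carr A \<Longrightarrow> b \<in> carr A \<Longrightarrow> c \<in> carr A \<Longrightarrow> mul A (a + b) c = mul A a c + mul A b c"
  "a \<in> carr A \<Longrightarrow> b \<in> carr A \<Longrightarrow> c \<in> carr A \<Longrightarrow> mul A c (a + b) = mul A c a + mul A c b"
  using zinbiel_A unfolding zinbiel_def is_algebra_def by auto

lemma mul_diff:
  assumes "a \<in> carr A" "b \<in> carr A" "c \<in> carr A"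
  shows "mul A (a - b) c = mul A a c - mul A b c" "mul A c (a - b) = mul A c a - mul A c b"
  using mul_add[of "a - b" b c] assms by (simp_all add: algebra_simps)

lemma mul_zero: "a \<in> carr A \<Longrightarrow> mul A 0 a = 0" "a \<in> carr A \<Longrightarrow> mul A a 0 = 0"
  using mul_diff[of a a a] by simp_all

lemma mul_minus:
  assumes "a \<in> carr A" "c \<in> carr A"
  shows "mul A (- a) c = - mul A a c" "mul A c (- a) = - mul A c a"
  using mul_diff[of 0 a c] assms by (simp_all add: mul_zero)

text \<open>Read from left to right, this rewrites every product as a sum of left-normed products,
  so that identities can be checked by expansion.\<close>

lemma mul_mul:
  "a \<in> carr A \<Longrightarrow> b \<in> carr A \<Longrightarrow> c \<in> carr A \<Longrightarrow>
     mul A a (mul A b c) = mul A (mul A a b) c + mul A (mul A b a) c"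
  using zinbiel_A by (simp add: zinbiel_def mul_add(1)[symmetric])

lemmas expand = mul_add mul_diff mul_minus mul_zero mul_mul

abbreviation commutator where "commutator a b \<equiv> mul A a b - mul A b a"

lemma commutator_tortkara:
  assumes "a \<in> carr A" "b \<in> carr A" "c \<in> carr A"
  shows "commutator (commutator a b) (commutator c b) =
    commutator (commutator (commutator a b) c + commutator (commutator b c) a +
      commutator (commutator c a) b) b"
  using assms by (simp add: expand algebra_simps)

end

lemma ST_tortkara:
  fixes p q r :: "'x list \<Rightarrow>\<^sub>0 'k::field"
  assumes "p \<in> carr (ST X)" "q \<in> carr (ST X)" "r \<in> carr (ST X)"
  shows "lie (lie p q) (lie r q) = lie (jacobian (ST X) p q r) q"
proof -
  interpret zinbiel_algebra "Zin X :: ('k, 'x list \<Rightarrow>\<^sub>0 'k) alg"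
    by unfold_locales (rule zinbiel_Zin)
  show ?thesis
    using commutator_tortkara[of p q r] ST_sub_Zin assms
    unfolding jacobian_def ST_simps lie_def Zin_simps by blast
qed

locale ST_image =
  fixes X :: "'x set" and f :: "('x list \<Rightarrow>\<^sub>0 'k::field) \<Rightarrow> 'b::ab_group_add" and B :: "('k, 'b) alg"
  assumes algebra_B: "is_algebra B" and hom: "alg_hom f (ST X) B" and surj: "f ` carr (ST X) = carr B"
begin

lemma f_add: "p \<in> carr (ST X) \<Longrightarrow> q \<in> carr (ST X) \<Longrightarrow> f (p + q) = f p + f q"
  and f_scale: "p \<in> carr (ST X) \<Longrightarrow> f (pm_scale r p) = scl B r (f p)"
  and f_lie: "p \<in> carr (ST X) \<Longrightarrow> q \<in> carr (ST X) \<Longrightarrow> f (lie p q) = mul B (f p) (f q)"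
  using hom by (simp_all add: alg_hom_def)

lemma f_zero: "f 0 = 0"
  using f_add[of 0 0] pm.subspace_0[OF subspace_ST] by auto

lemma scl_zero: "scl B c 0 = 0"
  using f_scale[OF pm.subspace_0[OF subspace_ST], of c] by (simp add: f_zero)

lemma f_neg: "p \<in> carr (ST X) \<Longrightarrow> f (- p) = - f p"
  using f_add[of p "- p"] pm.subspace_neg[OF subspace_ST] f_zero
  by (auto simp: eq_neg_iff_add_eq_0 add.commute)

lemma f_diff: "p \<in> carr (ST X) \<Longrightarrow> q \<in> carr (ST X) \<Longrightarrow> f (p - q) = f p - f q"
  using f_add[of p "- q"] f_neg[of q] pm.subspace_neg[OF subspace_ST, of q] by simp

lemma tortkara_image: "tortkara B"
  unfolding tortkara_def
proof (intro conjI ballI)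
  fix a b assume "a \<in> carr B" "b \<in> carr B"
  then obtain p q where pq: "p \<in> carr (ST X)" "q \<in> carr (ST X)" "a = f p" "b = f q"
    using surj by blast
  have "f (lie p q) = - f (lie q p)"
    using f_neg[OF lie_ST[OF pq(2,1)]] lie_anticomm[of p q] by simp
  then show "mul B a b = - mul B b a" using pq by (simp add: f_lie)
  fix c assume "c \<in> carr B"
  then obtain r where r: "r \<in> carr (ST X)" "c = f r" using surj by blast
  have "f (lie (lie p q) (lie r q)) = f (lie (jacobian (ST X) p q r) q)"
    using ST_tortkara[OF pq(1,2) r(1)] by simp
  then show "mul B (mul B a b) (mul B c b) = mul B (jacobian B a b c) b"
    using pq r by (simp add: f_lie f_add lie_ST jacobian_def pm.subspace_add[OF subspace_ST] del: lie_linear)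
qed (rule algebra_B)

end

lemma homomorphic_image_ST_iff:
  "homomorphic_image (ST X) B \<longleftrightarrow> (\<exists>f. ST_image X f B)"
  by (auto simp: homomorphic_image_def ST_image_def)

lemma tortkara_homomorphic_image: "homomorphic_image (ST X) B \<Longrightarrow> tortkara B"
  unfolding homomorphic_image_ST_iff using ST_image.tortkara_image by blast

text \<open>The quotient of the free Zinbiel algebra by \<open>J\<close> is realised on a linear complement of \<open>J\<close>.\<close>

lemma special_if_ideal_separates:
  fixes B :: "('k::field, 'b::ab_group_add) alg"
  assumes img: "ST_image X f B"
    and sub: "pm.subspace J" and J_Zin: "J \<subseteq> carr (Zin X)"
    and left: "\<And>p j. p \<in> carr (Zin X) \<Longrightarrow> j \<in> J \<Longrightarrow> zin_mul p j \<in> J"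
    and right: "\<And>p j. p \<in> carr (Zin X) \<Longrightarrow> j \<in> J \<Longrightarrow> zin_mul j p \<in> J"
    and ker: "\<And>p. p \<in> carr (ST X) \<Longrightarrow> p \<in> J \<longleftrightarrow> f p = 0"
  shows "special B"
proof -
  interpret img: ST_image X f B by (rule img)
  interpret VP: vector_space_pair "pm_scale :: 'k \<Rightarrow> ('a list \<Rightarrow>\<^sub>0 'k) \<Rightarrow> _" pm_scale ..
  \<comment> \<open>A linear projection onto \<open>J\<close>; then \<open>p - g p\<close> is a
    representative of the class of \<open>p\<close> modulo \<open>J\<close>.\<close>
  obtain g where g: "range g \<subseteq> J" "pm_linear g" "\<forall>v\<in>J. g v = v"
    using VP.linear_exists_left_inverse_on[OF linear_ident sub] by auto
  define \<pi> where "\<pi> p = p - g p" for p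
  have lin: "pm_linear \<pi>"
    unfolding \<pi>_def by (rule pm_linearI) (simp_all add: pm_linearD[OF g(2)] pm.scale_right_diff_distrib)
  note [simp] = pm_linearD[OF lin]
  have \<pi>_J: "\<pi> p = 0 \<longleftrightarrow> p \<in> J" for p
    unfolding \<pi>_def using g(1,3) by (metis eq_iff_diff_eq_0 rangeI subsetD)
  have \<pi>_diff: "p - \<pi> p \<in> J" for p unfolding \<pi>_def using g(1) by auto
  have \<pi>_eq: "\<pi> p = \<pi> q \<longleftrightarrow> p - q \<in> J" for p q
    using \<pi>_J[of "p - q"] by simp
  have \<pi>\<pi>[simp]: "\<pi> (\<pi> p) = \<pi> p" for p
    using \<pi>_diff[of p] \<pi>_J[of "p - \<pi> p"] by simp
  have \<pi>_Zin: "\<pi> p \<in> carr (Zin X)" if "p \<in> carr (Zin X)" for p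
    unfolding \<pi>_def using that g(1) J_Zin by (intro pm.subspace_diff[OF subspace_Zin]) auto
  have \<pi>_mul: "\<pi> (zin_mul (\<pi> p) q) = \<pi> (zin_mul p q)" "\<pi> (zin_mul q (\<pi> p)) = \<pi> (zin_mul q p)"
    if "q \<in> carr (Zin X)" for p q
    using right[OF that \<pi>_diff[of p]] left[OF that \<pi>_diff[of p]] \<pi>_J by (simp_all del: \<pi>\<pi> add: \<pi>_J[symmetric])
  define C where "C = \<lparr>carr = \<pi> ` carr (Zin X), scl = pm_scale, mul = \<lambda>p q. \<pi> (zin_mul p q)\<rparr>"
  have CE: "p \<in> carr (Zin X) \<and> p = \<pi> p" if "p \<in> carr C" for p
    using that \<pi>_Zin by (auto simp: C_def)
  have "zinbiel C"
    unfolding zinbiel_def is_algebra_def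
  proof (intro conjI allI ballI)
    show "vector_space (scl C)" by (simp add: C_def vector_space_pm_scale)
    interpret L: Vector_Spaces.linear pm_scale pm_scale \<pi> by (rule lin)
    show "module.subspace (scl C) (carr C)"
      using L.subspace_image[OF subspace_Zin] by (simp add: C_def)
    fix p q r c assume "p \<in> carr C" "q \<in> carr C"
    then have pq: "p \<in> carr (Zin X)" "q \<in> carr (Zin X)" using CE by blast+
    show "mul C p q \<in> carr C" using zin_mul_in_Zin[OF pq] by (simp add: C_def)
    show "mul C (scl C c p) q = scl C c (mul C p q)" "mul C p (scl C c q) = scl C c (mul C p q)"
      by (simp_all add: C_def)
    assume "r \<in> carr C"
    then have r: "r \<in> carr (Zin X)" using CE by blast
    show "mul C (p + q) r = mul C p r + mul C q r" "mul C p (q + r) = mul C p q + mul C p r"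
      by (simp_all add: C_def)
    have "zin_mul p (zin_mul q r) = zin_mul (zin_mul p q + zin_mul q p) r"
      using zinbiel_Zin[of X] pq r unfolding zinbiel_def Zin_simps by blast
    then show "mul C p (mul C q r) = mul C (mul C p q + mul C q p) r"
      using pq r by (simp add: C_def \<pi>_mul)
  qed
  moreover have sub_Zin: "p \<in> carr (ST X) \<Longrightarrow> p \<in> carr (Zin X)" for p using ST_sub_Zin by blast
  define U where "U = \<pi> ` carr (ST X)"
  have lieU: "\<pi> (zin_mul (\<pi> p) (\<pi> q)) - \<pi> (zin_mul (\<pi> q) (\<pi> p)) = \<pi> (lie p q)"
    if "p \<in> carr (ST X)" "q \<in> carr (ST X)" for p q
    using that[THEN sub_Zin] \<pi>_Zin by (simp add: \<pi>_mul lie_def)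
  have "subalgebra U (minus_algebra C)"
    unfolding subalgebra_def
  proof (intro conjI ballI)
    interpret L: Vector_Spaces.linear pm_scale pm_scale \<pi> by (rule lin)
    show "U \<subseteq> carr (minus_algebra C)" using sub_Zin by (auto simp: U_def C_def minus_algebra_def)
    show "module.subspace (scl (minus_algebra C)) U"
      using L.subspace_image[OF subspace_ST] by (simp add: U_def C_def minus_algebra_def)
    fix a b assume "a \<in> U" "b \<in> U"
    then show "mul (minus_algebra C) a b \<in> U"
      by (auto simp: U_def C_def minus_algebra_def lieU simp del: pm_linearD intro!: imageI lie_ST)
  qed
  moreover have "isomorphic B ((minus_algebra C)\<lparr>carr := U\<rparr>)"
  proof -
    have eq_iff: "f p = f q \<longleftrightarrow> \<pi> p = \<pi> q" if "p \<in> carr (ST X)" "q \<in> carr (ST X)" for p q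
      using ker[OF pm.subspace_diff[OF subspace_ST that]] img.f_diff[OF that] \<pi>_eq by simp
    \<comment> \<open>A preimage under \<open>f\<close> is chosen; by \<open>eq_iff\<close> its
      class modulo \<open>J\<close> does not depend on the choice.\<close>
    define h where "h b = \<pi> (SOME p. p \<in> carr (ST X) \<and> f p = b)" for b
    have h: "h (f p) = \<pi> p" if "p \<in> carr (ST X)" for p
    proof -
      have "(SOME q. q \<in> carr (ST X) \<and> f q = f p) \<in> carr (ST X) \<and> f (SOME q. q \<in> carr (ST X) \<and> f q = f p) = f p"
        by (rule someI[of _ p]) (use that in simp)
      then show ?thesis unfolding h_def using eq_iff that by blast
    qed
    have "bij_betw h (carr B) U"
      unfolding bij_betw_def inj_on_def img.surj[symmetric] U_def by (auto simp: h eq_iff image_iff)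
    moreover have "alg_hom h B ((minus_algebra C)\<lparr>carr := U\<rparr>)"
      unfolding alg_hom_def img.surj[symmetric]
      by (auto simp: h U_def C_def minus_algebra_def lieU lie_ST
          img.f_add[symmetric] img.f_scale[symmetric] img.f_lie[symmetric]
          pm.subspace_add[OF subspace_ST] pm.subspace_scale[OF subspace_ST])
    ultimately show ?thesis unfolding isomorphic_def by auto
  qed
  \<comment> \<open>\<open>C\<close> lives on words over the generators, while
    \<open>special\<close> asks for words over the elements of \<open>B\<close>;
    \<open>special_if_embeds\<close> removes the mismatch.\<close>
  ultimately show ?thesis using special_if_embeds img.tortkara_image by blast
qed

theorem special_two_generators:
  fixes B :: "('k::field_char_0, 'b::ab_group_add) alg" and x y :: 'x
  assumes "x \<noteq> y" "homomorphic_image (ST {x, y} :: ('k, 'x list \<Rightarrow>\<^sub>0 'k) alg) B"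
  shows "special B"
proof -
  obtain f where f: "ST_image {x, y} (f :: ('x list \<Rightarrow>\<^sub>0 'k) \<Rightarrow> _) B"
    using assms(2) homomorphic_image_ST_iff by blast
  interpret img: ST_image "{x, y}" f B by (rule f)
  define I where "I = {p \<in> carr (ST {x, y}). f p = 0}"
  have zero: "mul B (f p) 0 = 0" if "p \<in> carr (ST {x, y})" for p
    using img.f_lie[OF that pm.subspace_0[OF subspace_ST]] img.f_zero by simp
  interpret two_generator_ideal x y I
  proof
    show "pm.subspace I" unfolding I_def
      by (rule pm.subspaceI)
        (auto simp: img.f_zero img.f_add img.f_scale img.scl_zero pm.subspace_0[OF subspace_ST]
          pm.subspace_add[OF subspace_ST] pm.subspace_scale[OF subspace_ST])
    fix p i :: "'x list \<Rightarrow>\<^sub>0 'k" assume p: "p \<in> ST2 x y" and i: "i \<in> I"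
    then show "lie p i \<in> I" by (auto simp: I_def carr_ST2[symmetric] lie_ST img.f_lie zero)
  qed (use assms in \<open>auto simp: I_def carr_ST2\<close>)
  show ?thesis
  proof (rule special_if_ideal_separates[OF f subspace_J])
    show "J \<subseteq> carr (Zin {x, y})" using J_Zin by blast
    show "p \<in> J \<longleftrightarrow> f p = 0" if "p \<in> carr (ST {x, y})" for p
      using that I_J[of p] J_inter_ST2[of p] I_def by (auto simp: carr_ST2)
  qed (auto intro: J_zin_mul_left J_zin_mul_right simp: carr_Zin_polys)
qed

section \<open>A quotient in three generators that is not special\<close>

text \<open>Stripping \<open>b\<close> and then \<open>a\<close> from \<open>p \<circ> q\<close>
  gives \<open>rder a p \<squnion> rder b q + p \<squnion> rder a (rder b q)\<close>. In the
  commutator, symmetrised over \<open>a\<close> and \<open>b\<close>, the first kind of term cancels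
  and the second vanishes by the antisymmetry of \<open>p\<close> and \<open>q\<close>.\<close>

lemma ST_rder_antisym:
  fixes p :: "'x list \<Rightarrow>\<^sub>0 'k::field"
  assumes "p \<in> carr (ST X)"
  shows "rder a (rder b p) = - rder b (rder a p)"
proof -
  define U where "U = {p \<in> carr (Zin X :: ('k, 'x list \<Rightarrow>\<^sub>0 'k) alg). \<forall>a b. rder a (rder b p) + rder b (rder a p) = 0}"
  have "carr (ST X) \<subseteq> U"
  proof (rule ST_subset)
    show "pm.subspace U"
    proof (rule pm.subspaceI)
      show "0 \<in> U" by (simp add: U_def pm.subspace_0[OF subspace_Zin])
    next
      fix p q assume pq: "p \<in> U" "q \<in> U"
      then have "rder a (rder b p) + rder b (rder a p) + (rder a (rder b q) + rder b (rder a q)) = 0" for a b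
        by (simp add: U_def)
      with pq show "p + q \<in> U"
        unfolding U_def by (simp add: pm.subspace_add[OF subspace_Zin] algebra_simps)
    next
      fix c p assume "p \<in> U"
      then show "pm_scale c p \<in> U"
        unfolding U_def by (simp add: pm.subspace_scale[OF subspace_Zin] flip: pm.scale_right_distrib)
    qed
    fix p q assume p: "p \<in> U" and q: "q \<in> U"
    then have Z: "p \<in> carr (Zin X)" "q \<in> carr (Zin X)"
      "Poly_Mapping.lookup p [] = 0" "Poly_Mapping.lookup q [] = 0"
      by (auto simp: U_def carr_Zin_polys)
    have "rder a (rder b (lie p q)) + rder b (rder a (lie p q)) = 0" for a b
    proof -
      have "rder a (rder b p) = - rder b (rder a p)" "rder a (rder b q) = - rder b (rder a q)"
        using p q by (simp_all add: U_def eq_neg_iff_add_eq_0)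
      then show ?thesis
        by (simp add: lie_def rder_zin_mul rder_shp Z) (simp add: shp_commute)
    qed
    then show "lie p q \<in> U" using lie_in_Zin[OF Z(1,2)] by (simp add: U_def)
  qed (auto simp: U_def letter_in_Zin)
  then have "p \<in> U" using assms by blast
  then show ?thesis by (simp add: U_def eq_neg_iff_add_eq_0)
qed

lemma ST_coeff_antisym:
  fixes p :: "'x list \<Rightarrow>\<^sub>0 'k::field"
  assumes "p \<in> carr (ST X)"
  shows "Poly_Mapping.lookup p (w @ [a, b]) = - Poly_Mapping.lookup p (w @ [b, a])"
  using arg_cong[OF ST_rder_antisym[OF assms, of b a], of "\<lambda>q. Poly_Mapping.lookup q w"] by simp

lemma lookup_shp_snoc:
  "Poly_Mapping.lookup (shp p q) (w @ [a]) =
     Poly_Mapping.lookup (shp (rder a p) q) w + Poly_Mapping.lookup (shp p (rder a q)) w"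
  by (simp flip: lookup_rder add: rder_shp lookup_add)

lemmas lookup_shp_Cons =
  lookup_shp_snoc[of _ _ "[]", simplified] lookup_shp_snoc[of _ _ "[b]" for b, simplified]
  lookup_shp_snoc[of _ _ "[b, c]" for b c, simplified]

lemma lookup_zin_mul_snoc:
  assumes "q \<in> carr (Zin X)"
  shows "Poly_Mapping.lookup (zin_mul p q) (w @ [a]) = Poly_Mapping.lookup (shp p (rder a q)) w"
  using assms by (simp flip: lookup_rder add: rder_zin_mul carr_Zin_polys)

text \<open>Sums over the splittings of the word into two nonempty subwords, the last letter always
  going to \<open>q\<close>.\<close>

lemma lookup_zin_mul:
  assumes "p \<in> carr (Zin X)" "q \<in> carr (Zin X)"
  shows "Poly_Mapping.lookup (zin_mul p q) [a] = 0"
    "Poly_Mapping.lookup (zin_mul p q) [a, b] = Poly_Mapping.lookup p [a] * Poly_Mapping.lookup q [b]"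
    "Poly_Mapping.lookup (zin_mul p q) [a, b, c] =
       Poly_Mapping.lookup p [a] * Poly_Mapping.lookup q [b, c] +
       Poly_Mapping.lookup p [b] * Poly_Mapping.lookup q [a, c] +
       Poly_Mapping.lookup p [a, b] * Poly_Mapping.lookup q [c]"
    "Poly_Mapping.lookup (zin_mul p q) [a, b, c, d] =
       Poly_Mapping.lookup p [a] * Poly_Mapping.lookup q [b, c, d] +
       Poly_Mapping.lookup p [b] * Poly_Mapping.lookup q [a, c, d] +
       Poly_Mapping.lookup p [c] * Poly_Mapping.lookup q [a, b, d] +
       Poly_Mapping.lookup p [a, b] * Poly_Mapping.lookup q [c, d] +
       Poly_Mapping.lookup p [a, c] * Poly_Mapping.lookup q [b, d] +
       Poly_Mapping.lookup p [b, c] * Poly_Mapping.lookup q [a, d] +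
       Poly_Mapping.lookup p [a, b, c] * Poly_Mapping.lookup q [d]"
  using lookup_zin_mul_snoc[OF assms(2), of p "[]" a] lookup_zin_mul_snoc[OF assms(2), of p "[a]" b]
    lookup_zin_mul_snoc[OF assms(2), of p "[a, b]" c] lookup_zin_mul_snoc[OF assms(2), of p "[a, b, c]" d]
    assms
  by (simp_all add: carr_Zin_polys lookup_shp_Cons)

section \<open>A relation forced by the Zinbiel identity\<close>

context zinbiel_algebra
begin

text \<open>In left-normed products the first two relations say \<open>xxy = xyx\<close> and
  \<open>xxz = xzx\<close>, and the sum of the last two says \<open>xyz = xzy\<close>. The claim is
  a combination of left multiples of these, which no longer are commutators; this is what an
  embedding adds to the Tortkara structure.\<close>

lemma commutator_zero:
  fixes x y z
  assumes char: "(2 :: 'k) \<noteq> 0" "(3 :: 'k) \<noteq> 0"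
    and carr: "x \<in> carr A" "y \<in> carr A" "z \<in> carr A"
    and xr: "commutator x (commutator x y) = 0" and xq: "commutator x (commutator z x) = 0"
    and yq: "commutator y (commutator z x) = 0" and zr: "commutator z (commutator x y) = 0"
  shows "commutator (commutator z x) (commutator x y) = 0"
proof -
  have two: "u = v" if "u + u = v + v" for u v :: 'v
  proof -
    have "scl A 2 (u - v) = (u - v) + (u - v)"
      using scale_left_distrib[of 1 1 "u - v"] by simp
    also have "\<dots> = (u + u) - (v + v)" by (simp add: algebra_simps)
    finally show ?thesis using that char(1) by simp
  qed
  have three: "u = v" if "u + (u + u) = v + (v + v)" for u v :: 'v
  proof -
    have "scl A 3 (u - v) = (u - v) + ((u - v) + (u - v))"
      using scale_left_distrib[of 1 2 "u - v"] scale_left_distrib[of 1 1 "u - v"] by simp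
    also have "\<dots> = (u + (u + u)) - (v + (v + v))" by (simp add: algebra_simps)
    finally show ?thesis using that char(2) by simp
  qed
  note expand' = expand carr algebra_simps
  have xxy: "mul A (mul A x x) y = mul A (mul A x y) x"
    by (rule two) (use xr in \<open>simp add: expand'\<close>)
  have xxz: "mul A (mul A x x) z = mul A (mul A x z) x"
    by (rule two) (use xq in \<open>simp add: expand'\<close>)
  have xyz: "mul A (mul A x y) z = mul A (mul A x z) y"
  proof (rule two)
    have "commutator y (commutator z x) + commutator z (commutator x y) = 0" unfolding yq zr by simp
    then show "mul A (mul A x y) z + mul A (mul A x y) z = mul A (mul A x z) y + mul A (mul A x z) y"
      by (simp add: expand')
  qed
  have eq: "mul A (mul A (mul A x x) y) z = mul A (mul A (mul A x x) z) y" (is "?a = ?b")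
  proof (rule three)
    \<comment> \<open>\<open>x \<circ> ((xy)z)\<close> expands to
      \<open>2 ((xx)y)z + ((xy)x)z\<close>, and \<open>xxy\<close> turns the last term into a third
      copy.\<close>
    have "mul A x (mul A (mul A x y) z) - mul A x (mul A (mul A x z) y) = ?a + (?a + ?a) - (?b + (?b + ?b))"
      by (simp add: expand' flip: xxy xxz)
    then show "?a + (?a + ?a) = ?b + (?b + ?b)" by (simp add: xyz)
  qed
  \<comment> \<open>\<open>d u v w\<close> is the left multiple by \<open>u\<close> of the relation
    \<open>(vv)w = (vw)v\<close>.\<close>
  define d where "d u v w = mul A u (mul A (mul A v v) w) - mul A u (mul A (mul A v w) v)" for u v w
  have "commutator (commutator z x) (commutator x y) = d z x y + d z x y - (d y x z + d y x z)"
    by (simp add: d_def expand') (simp add: algebra_simps eq flip: xxy xxz)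
  moreover have "d z x y = 0" "d y x z = 0"
    by (simp_all add: d_def xxy xxz)
  ultimately show ?thesis by simp
qed

end

section \<open>The eight-dimensional quotient\<close>

context
  fixes x y z :: 'x
begin

text \<open>
  The image of \<open>proj\<close> has the basis \<open>x\<close>, \<open>y\<close>, \<open>z\<close>, \<open>p = [y, z]\<close>, \<open>q = [z, x]\<close>, \<open>r = [x, y]\<close>, \<open>e\<close>, \<open>f\<close> with the further
  products \<open>[x, p] = -2 e\<close>, \<open>[x, e] = 3 f\<close>, \<open>[q, r] = 6 f\<close>, and all others zero. The words \<open>yzx\<close> and \<open>xxyz\<close>
  stand for \<open>e\<close> and \<open>f\<close>, whose coefficients are \<open>E_coeff\<close> and \<open>F_coeff\<close>.
\<close>

definition E_coeff :: "('x list \<Rightarrow>\<^sub>0 'k::field) \<Rightarrow> 'k" where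
  "E_coeff p = Poly_Mapping.lookup p [y, z, x] + Poly_Mapping.lookup p [z, x, y]"

definition F_coeff :: "('x list \<Rightarrow>\<^sub>0 'k::field) \<Rightarrow> 'k" where
  "F_coeff p = Poly_Mapping.lookup p [x, x, y, z] + Poly_Mapping.lookup p [x, y, z, x] +
     Poly_Mapping.lookup p [x, z, x, y] + Poly_Mapping.lookup p [y, x, z, x] + Poly_Mapping.lookup p [z, x, x, y]"

definition proj :: "('x list \<Rightarrow>\<^sub>0 'k::field) \<Rightarrow> 'x list \<Rightarrow>\<^sub>0 'k" where
  "proj p = Poly_Mapping.single [x] (Poly_Mapping.lookup p [x]) +
     Poly_Mapping.single [y] (Poly_Mapping.lookup p [y]) + Poly_Mapping.single [z] (Poly_Mapping.lookup p [z]) +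
     Poly_Mapping.single [y, z] (Poly_Mapping.lookup p [y, z]) +
     Poly_Mapping.single [z, x] (Poly_Mapping.lookup p [z, x]) +
     Poly_Mapping.single [x, y] (Poly_Mapping.lookup p [x, y]) +
     Poly_Mapping.single [y, z, x] (E_coeff p) + Poly_Mapping.single [x, x, y, z] (F_coeff p)"

definition bmul :: "('x list \<Rightarrow>\<^sub>0 'k::field) \<Rightarrow> ('x list \<Rightarrow>\<^sub>0 'k) \<Rightarrow> 'x list \<Rightarrow>\<^sub>0 'k" where
  "bmul u v = (let c = Poly_Mapping.lookup; w = (\<lambda>a b. c u a * c v b - c u b * c v a) in
     Poly_Mapping.single [y, z] (w [y] [z]) + Poly_Mapping.single [z, x] (w [z] [x]) +
     Poly_Mapping.single [x, y] (w [x] [y]) + Poly_Mapping.single [y, z, x] (- 2 * w [x] [y, z]) +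
     Poly_Mapping.single [x, x, y, z] (3 * w [x] [y, z, x] + 6 * w [z, x] [x, y]))"

lemma linear_proj: "pm_linear proj"
  by (rule pm_linearI; rule poly_mapping_eqI)
    (simp_all add: proj_def E_coeff_def F_coeff_def lookup_add lookup_single when_def algebra_simps)

lemma bmul_bilinear:
  "bmul (u + u') v = bmul u v + bmul u' v" "bmul u (v + v') = bmul u v + bmul u v'"
  "bmul (pm_scale c u) v = pm_scale c (bmul u v)" "bmul u (pm_scale c v) = pm_scale c (bmul u v)"
  by (rule poly_mapping_eqI; simp add: bmul_def Let_def lookup_add lookup_single when_def algebra_simps)+

context
  assumes distinct: "distinct [x, y, z]"
begin

text \<open>Up to a factor, \<open>E_coeff\<close> is the only functional on the span of
  \<open>[x, [y, z]]\<close>, \<open>[y, [z, x]]\<close>, \<open>[z, [x, y]]\<close> that kills the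
  last two; its value on the first is -2.\<close>

lemma E_coeff_lie:
  assumes "p \<in> carr (ST X)" "q \<in> carr (ST X)"
  shows "E_coeff (lie p q) = - 2 * (Poly_Mapping.lookup p [x] * Poly_Mapping.lookup q [y, z] -
    Poly_Mapping.lookup p [y, z] * Poly_Mapping.lookup q [x])"
proof -
  have Z: "p \<in> carr (Zin X)" "q \<in> carr (Zin X)" using assms ST_sub_Zin by blast+
  have anti: "Poly_Mapping.lookup r [z, y] = - Poly_Mapping.lookup r [y, z]"
    "Poly_Mapping.lookup r [x, z] = - Poly_Mapping.lookup r [z, x]"
    "Poly_Mapping.lookup r [y, x] = - Poly_Mapping.lookup r [x, y]" if "r \<in> carr (ST X)" for r :: "'x list \<Rightarrow>\<^sub>0 'a"
    by (rule ST_coeff_antisym[OF that, of "[]", unfolded append.simps])+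
  show ?thesis
    by (simp add: E_coeff_def lie_def lookup_minus lookup_zin_mul[OF Z] lookup_zin_mul[OF Z(2,1)]
        anti[OF assms(1)] anti[OF assms(2)] algebra_simps)
qed

text \<open>The five words are balanced so that brackets of \<open>y\<close> or \<open>z\<close>
  with elements of degree three contribute nothing, while \<open>[[z, x], [x, y]]\<close> gets the
  nonzero value 6.\<close>

lemma F_coeff_lie:
  fixes p q :: "'x list \<Rightarrow>\<^sub>0 'k::field_char_0"
  assumes "p \<in> carr (ST X)" "q \<in> carr (ST X)"
  shows "F_coeff (lie p q) = 3 * (Poly_Mapping.lookup p [x] * E_coeff q - E_coeff p * Poly_Mapping.lookup q [x]) +
    6 * (Poly_Mapping.lookup p [z, x] * Poly_Mapping.lookup q [x, y] - Poly_Mapping.lookup p [x, y] * Poly_Mapping.lookup q [z, x])"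
proof -
  have Z: "p \<in> carr (Zin X)" "q \<in> carr (Zin X)" using assms ST_sub_Zin by blast+
  have anti: "Poly_Mapping.lookup r [z, y] = - Poly_Mapping.lookup r [y, z]"
    "Poly_Mapping.lookup r [x, z] = - Poly_Mapping.lookup r [z, x]"
    "Poly_Mapping.lookup r [y, x] = - Poly_Mapping.lookup r [x, y]"
    "Poly_Mapping.lookup r [a, z, y] = - Poly_Mapping.lookup r [a, y, z]"
    "Poly_Mapping.lookup r [a, x, z] = - Poly_Mapping.lookup r [a, z, x]"
    "Poly_Mapping.lookup r [a, y, x] = - Poly_Mapping.lookup r [a, x, y]" if "r \<in> carr (ST X)" for r :: "'x list \<Rightarrow>\<^sub>0 'k" and a
    by (rule ST_coeff_antisym[OF that, of "[]", unfolded append.simps]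
        ST_coeff_antisym[OF that, of "[a]", unfolded append.simps])+
  have self_neg: "c = 0" if "c = - c" for c :: 'k
    using that by (simp add: eq_neg_iff_add_eq_0 flip: mult_2)
  have sq: "Poly_Mapping.lookup r [a, a] = 0" "Poly_Mapping.lookup r [b, a, a] = 0" 
     if "r \<in> carr (ST X)" for r :: "'x list \<Rightarrow>\<^sub>0 'k" and a b
    by (rule self_neg[OF ST_coeff_antisym[OF that, of "[]" a a, unfolded append.simps]]
        self_neg[OF ST_coeff_antisym[OF that, of "[b]" a a, unfolded append.simps]])+
  show ?thesis
    by (simp add: F_coeff_def E_coeff_def lie_def lookup_minus lookup_zin_mul[OF Z] lookup_zin_mul[OF Z(2,1)]
        anti[OF assms(1)] anti[OF assms(2)] sq[OF assms(1)] sq[OF assms(2)] algebra_simps)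
qed

lemma lookup_proj:
  "Poly_Mapping.lookup (proj p) [x] = Poly_Mapping.lookup p [x]"
  "Poly_Mapping.lookup (proj p) [y] = Poly_Mapping.lookup p [y]"
  "Poly_Mapping.lookup (proj p) [z] = Poly_Mapping.lookup p [z]"
  "Poly_Mapping.lookup (proj p) [y, z] = Poly_Mapping.lookup p [y, z]"
  "Poly_Mapping.lookup (proj p) [z, x] = Poly_Mapping.lookup p [z, x]"
  "Poly_Mapping.lookup (proj p) [x, y] = Poly_Mapping.lookup p [x, y]"
  "Poly_Mapping.lookup (proj p) [y, z, x] = E_coeff p"
  "Poly_Mapping.lookup (proj p) [x, x, y, z] = F_coeff p"
  using distinct by (auto simp: proj_def lookup_add lookup_single)

text \<open>The coefficients that \<open>proj\<close> retains in a bracket depend only on those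
  retained in the factors; hence its kernel in the free special Tortkara algebra is an
  ideal.\<close>

lemma proj_lie:
  fixes p q :: "'x list \<Rightarrow>\<^sub>0 'k::field_char_0"
  assumes "p \<in> carr (ST X)" "q \<in> carr (ST X)"
  shows "proj (lie p q) = bmul (proj p) (proj q)"
proof -
  have Z: "p \<in> carr (Zin X)" "q \<in> carr (Zin X)" using assms ST_sub_Zin by blast+
  have c: "Poly_Mapping.lookup (lie p q) [a] = 0" 
    "Poly_Mapping.lookup (lie p q) [a, b] = Poly_Mapping.lookup p [a] * Poly_Mapping.lookup q [b] -
       Poly_Mapping.lookup p [b] * Poly_Mapping.lookup q [a]" for a b
    by (simp_all add: lie_def lookup_minus lookup_zin_mul[OF Z] lookup_zin_mul[OF Z(2,1)])
  show ?thesis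
    unfolding proj_def[of "lie p q"] bmul_def Let_def lookup_proj c E_coeff_lie[OF assms] F_coeff_lie[OF assms]
    by simp
qed

definition proj_alg :: "('k::field, 'x list \<Rightarrow>\<^sub>0 'k) alg" where
  "proj_alg = \<lparr>carr = proj ` carr (ST {x, y, z}), scl = pm_scale, mul = bmul\<rparr>"

lemma homomorphic_image_proj_alg:
  "homomorphic_image (ST {x, y, z}) (proj_alg :: ('k::field_char_0, _) alg)"
  unfolding homomorphic_image_def
proof (intro conjI exI[of _ proj])
  interpret L: Vector_Spaces.linear pm_scale pm_scale "proj :: ('x list \<Rightarrow>\<^sub>0 'k) \<Rightarrow> _" by (rule linear_proj)
  show "is_algebra (proj_alg :: ('k, _) alg)"
    unfolding is_algebra_def
    by (auto simp: proj_alg_def vector_space_pm_scale L.subspace_image[OF subspace_ST] bmul_bilinear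
        lie_ST simp flip: proj_lie)
  show "alg_hom proj (ST {x, y, z}) (proj_alg :: ('k, _) alg)"
    by (auto simp: alg_hom_def proj_alg_def L.add L.scale proj_lie)
qed (simp add: proj_alg_def)

lemma not_special_proj_alg: "\<not> special (proj_alg :: ('k::field_char_0, _) alg)"
proof
  assume "special (proj_alg :: ('k::field_char_0, _) alg)"
  then obtain A :: "('k, ('x list \<Rightarrow>\<^sub>0 'k) list \<Rightarrow>\<^sub>0 'k) alg" and U g where A: "zinbiel A"
    and U: "subalgebra U (minus_algebra A)" and g: "alg_hom g proj_alg ((minus_algebra A)\<lparr>carr := U\<rparr>)"
    and bij: "bij_betw g (carr proj_alg) U"
    unfolding special_def isomorphic_def by auto
  interpret A: zinbiel_algebra A by unfold_locales (rule A)
  let ?B = "proj ` carr (ST {x, y, z}) :: ('x list \<Rightarrow>\<^sub>0 'k) set"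
  have g_mul: "g (bmul u v) = A.commutator (g u) (g v)" if "u \<in> ?B" "v \<in> ?B" for u v
    using g that by (auto simp: alg_hom_def proj_alg_def minus_algebra_def)
  have g_carr: "g u \<in> carr A" if "u \<in> ?B" for u
    using g that U by (auto simp: alg_hom_def proj_alg_def minus_algebra_def subalgebra_def)
  have bmul_B: "bmul u v \<in> ?B" if "u \<in> ?B" "v \<in> ?B" for u v
    using that by (auto simp: lie_ST simp flip: proj_lie)
  have zero_B: "0 \<in> ?B"
    using pm.subspace_0[OF subspace_ST] pm_linearD(4)[OF linear_proj] by (metis imageI)
  define vx vy vz vr vq where b: "vx = Poly_Mapping.single [x] (1::'k)" "vy = Poly_Mapping.single [y] (1::'k)"
    "vz = Poly_Mapping.single [z] (1::'k)" "vr = Poly_Mapping.single [x, y] (1::'k)" 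
    "vq = Poly_Mapping.single [z, x] (1::'k)"
  have "vx = proj (letter x)" "vy = proj (letter y)" "vz = proj (letter z)"
    using distinct by (auto simp: b proj_def letter_def E_coeff_def F_coeff_def lookup_single)
  then have B: "vx \<in> ?B" "vy \<in> ?B" "vz \<in> ?B" by (auto intro!: imageI letter_ST)
  have mult: "bmul vx vy = vr" "bmul vz vx = vq" "bmul vx vr = 0" "bmul vx vq = 0"
    "bmul vy vq = 0" "bmul vz vr = 0" "bmul vq vr = Poly_Mapping.single [x, x, y, z] 6"
    using distinct by (auto simp: b bmul_def Let_def lookup_single)
  have B': "vr \<in> ?B" "vq \<in> ?B" using bmul_B[OF B(1,2)] bmul_B[OF B(3,1)] by (simp_all add: mult)
  have "g 0 = A.commutator (g 0) (g 0)" using g_mul[OF zero_B zero_B] by (simp add: bmul_def Let_def)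
  then have g0: "g 0 = 0" by simp
  have r: "g vr = A.commutator (g vx) (g vy)" and q: "g vq = A.commutator (g vz) (g vx)"
    using g_mul[OF B(1,2)] g_mul[OF B(3,1)] by (simp_all add: mult)
  \<comment> \<open>The four relations hold in \<open>proj_alg\<close>, so an embedding would kill
    \<open>[q, r]\<close>, which is six times a basis vector.\<close>
  have "A.commutator (g vq) (g vr) = 0"
    unfolding r q
  proof (rule A.commutator_zero)
    show "A.commutator (g vx) (A.commutator (g vx) (g vy)) = 0" "A.commutator (g vx) (A.commutator (g vz) (g vx)) = 0"
      "A.commutator (g vy) (A.commutator (g vz) (g vx)) = 0" "A.commutator (g vz) (A.commutator (g vx) (g vy)) = 0"
      using g_mul[OF B(1) B'(1)] g_mul[OF B(1) B'(2)] g_mul[OF B(2) B'(2)] g_mul[OF B(3) B'(1)]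
      unfolding r[symmetric] q[symmetric] by (simp_all add: mult g0)
  qed (use B g_carr in auto)
  then have "g (Poly_Mapping.single [x, x, y, z] 6) = g 0"
    using g_mul[OF B'(2,1)] by (simp add: mult g0)
  moreover have "Poly_Mapping.single [x, x, y, z] 6 \<in> ?B"
    using bmul_B[OF B'(2,1)] by (simp add: mult)
  moreover have "inj_on g ?B" using bij by (simp add: bij_betw_def proj_alg_def)
  ultimately have "Poly_Mapping.single [x, x, y, z] (6::'k) = 0"
    using zero_B inj_onD by metis
  from arg_cong[OF this, of "\<lambda>p. Poly_Mapping.lookup p [x, x, y, z]"] show False by simp
qed

end

end

theorem theorem2p6:
  shows "(\<forall>(x::'x) y. x \<noteq> y \<longrightarrow>
            (\<forall>B :: ('k::field_char_0, 'b::ab_group_add) alg.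
               homomorphic_image (ST {x, y} :: ('k, 'x list \<Rightarrow>\<^sub>0 'k) alg) B \<longrightarrow> special B))
       \<and> (\<forall>(x::'y) y z. distinct [x, y, z] \<longrightarrow>
            (\<exists>B :: ('k, 'y list \<Rightarrow>\<^sub>0 'k) alg.
               homomorphic_image (ST {x, y, z} :: ('k, 'y list \<Rightarrow>\<^sub>0 'k) alg) B
               \<and> tortkara B \<and> \<not> special B))"
proof (intro conjI allI impI)
  fix x y z :: 'y assume "distinct [x, y, z]"
  then show "\<exists>B :: ('k, 'y list \<Rightarrow>\<^sub>0 'k) alg.
      homomorphic_image (ST {x, y, z} :: ('k, 'y list \<Rightarrow>\<^sub>0 'k) alg) B \<and> tortkara B \<and> \<not> special B"
    by (intro exI[of _ "proj_alg x y z"] conjI tortkara_homomorphic_image[OF homomorphic_image_proj_alg]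
        homomorphic_image_proj_alg not_special_proj_alg)
qed (rule special_two_generators)

end
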